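(* Fix $M\ge1$ and let $g$ be a continuous function on $\mathbb R^M$. Then $$\lim_{N\to\infty}\mathbb E_{\mathrm{Ch},M,N}\Bigl[g\Bigl(\frac{\lambda_1-N/M}{\sqrt{2N/M}},\dots,\frac{\lambda_M-N/M}{\sqrt{2N/M}}\Bigr)\Bigr]=M!\sqrt{\pi M}\int_{\mathbb A_M}g(x)\,\phi_{\mathrm{GUE},M}(x)\,dx_1\cdots dx_{M-1},$$ where $\mathbb A_M=\{x\in\mathbb R^M:\ x_1>\dots>x_M\text{ and }x_1+\dots+x_M=0\}$. Furthermore, $$\lim_{\alpha\to\infty}\mathbb E_{\mathrm{Ch},M}^\alpha\Bigl[g\Bigl(\frac{\lambda_1-\alpha/M}{\sqrt{2\alpha/M}},\dots,\frac{\lambda_M-\alpha/M}{\sqrt{2\alpha/M}}\Bigr)\Bigr]=M!\int_{\{x\in\mathbb R^M:\,x_1>\dots>x_M\}}g(x)\,\phi_{\mathrm{GUE},M}(x)\,d^Mx.$$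
   Context: $\mathbb N=\{0,1,2,\dots\}$, $\Omega_M=\{\lambda\in\mathbb N^M:\lambda_1\ge\dots\ge\lambda_M\}$, $\Omega_M^{(N)}=\{\lambda\in\Omega_M:\sum_j\lambda_j=N\}$, $V_M(\lambda)=\prod_{1\le i<j\le M}(\lambda_i-\lambda_j+j-i)$, $W_M(\lambda)=\prod_{i=1}^M\frac1{(\lambda_i+M-i)!}$. $\mathbb E_{\mathrm{Ch},M,N}$ is expectation with respect to the probability measure on $\Omega_M^{(N)}$ $$\mathbb P_{\mathrm{Ch},M,N}[\{\lambda\}]=\frac{N!}{M^N}\Bigl(\prod_{j=1}^{M-1}\frac1{j!}\Bigr)V_M(\lambda)^2W_M(\lambda),$$ and, for $\alpha>0$, $\mathbb E_{\mathrm{Ch},M}^\alpha$ is expectation with respect to the Charlier ensemble on $\Omega_M$, $$\mathbb P_{\mathrm{Ch},M}^\alpha[\{\lambda\}]=\Bigl(\prod_{j=1}^{M-1}\frac1{j!}\Bigr)V_M(\lambda)^2W_M(\lambda)\prod_{i=1}^M\Bigl[\Bigl(\frac{\alpha}{M}\Bigr)^{\lambda_i}e^{-\alpha/M}\Bigr].$$ $\phi_{\mathrm{GUE},M}(x)=\frac1{Z_M}\prod_{1\le i<j\le M}(x_i-x_j)^2\prod_{j=1}^Me^{-x_j^2}$ with $Z_M=(2\pi)^{M/2}2^{-M^2/2}\prod_{j=1}^Mj!$, the probability density on $\mathbb R^M$ of the eigenvalues of an $M\times M$ matrix from the Gaussian Unitary Ensemble. In the integral over $\mathbb A_M$, the set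 is parametrized by $x_1,\dots,x_{M-1}$.
   Formalization: g is additionally assumed to grow at most exponentially, |g(x)| ≤ C exp(c(|x_1|+…+|x_M|)) for some constants C, c; for arbitrary continuous g the claim fails, e.g. M=1, g(x)=exp(|x|^{3/2}), where the Charlier expectation is infinite for every α. *)

theory Defs
  imports "HOL-Probability.Probability"
begin

(* Points of R^M and N^M are extensional functions on the index set {1..M}, so that
   coordinates are numbered 1, ..., M as in the paper; M varies freely over nat. *)

definition Omega :: "nat \<Rightarrow> (nat \<Rightarrow> nat) set" where
  "Omega M = {l \<in> {1..M} \<rightarrow>\<^sub>E UNIV. \<forall>i\<in>{1..M}. \<forall>j\<in>{1..M}. i \<le> j \<longrightarrow> l j \<le> l i}"

definition Omega_sum :: "nat \<Rightarrow> nat \<Rightarrow> (nat \<Rightarrow> nat) set" where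
  "Omega_sum M N = {l \<in> Omega M. (\<Sum>j=1..M. l j) = N}"

definition V :: "nat \<Rightarrow> (nat \<Rightarrow> nat) \<Rightarrow> real" where
  "V M l = (\<Prod>i\<in>{1..M}. \<Prod>j\<in>{i<..M}. real (l i) - real (l j) + real j - real i)"

definition W :: "nat \<Rightarrow> (nat \<Rightarrow> nat) \<Rightarrow> real" where
  "W M l = (\<Prod>i\<in>{1..M}. 1 / fact (l i + M - i))"

definition Ch_fixed :: "nat \<Rightarrow> nat \<Rightarrow> (nat \<Rightarrow> nat) measure" where
  "Ch_fixed M N = point_measure (Omega_sum M N)
     (\<lambda>l. ennreal (fact N / real M ^ N * (\<Prod>j\<in>{1..M-1}. 1 / fact j) * (V M l)\<^sup>2 * W M l))"

definition Charlier :: "nat \<Rightarrow> real \<Rightarrow> (nat \<Rightarrow> nat) measure" where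
  "Charlier M \<alpha> = point_measure (Omega M)
     (\<lambda>l. ennreal ((\<Prod>j\<in>{1..M-1}. 1 / fact j) * (V M l)\<^sup>2 * W M l *
        (\<Prod>i\<in>{1..M}. (\<alpha> / real M) ^ l i * exp (- \<alpha> / real M))))"

definition rescale :: "nat \<Rightarrow> real \<Rightarrow> (nat \<Rightarrow> nat) \<Rightarrow> nat \<Rightarrow> real" where
  "rescale M t l = (\<lambda>i\<in>{1..M}. (real (l i) - t / real M) / sqrt (2 * t / real M))"

definition Z_GUE :: "nat \<Rightarrow> real" where
  "Z_GUE M = (2 * pi) powr (real M / 2) * 2 powr (- ((real M)\<^sup>2 / 2)) * (\<Prod>j\<in>{1..M}. fact j)"

definition phi_GUE :: "nat \<Rightarrow> (nat \<Rightarrow> real) \<Rightarrow> real" where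
  "phi_GUE M x = 1 / Z_GUE M * (\<Prod>i\<in>{1..M}. \<Prod>j\<in>{i<..M}. (x i - x j)\<^sup>2) *
     (\<Prod>j\<in>{1..M}. exp (- (x j)\<^sup>2))"

definition chamber :: "nat \<Rightarrow> (nat \<Rightarrow> real) set" where
  "chamber M = {x \<in> {1..M} \<rightarrow>\<^sub>E UNIV. \<forall>i\<in>{1..M}. \<forall>j\<in>{1..M}. i < j \<longrightarrow> x j < x i}"

definition A_set :: "nat \<Rightarrow> (nat \<Rightarrow> real) set" where
  "A_set M = {x \<in> chamber M. (\<Sum>i=1..M. x i) = 0}"

(* The parametrization (x_1, ..., x_(M-1)) |-> x of the hyperplane x_1 + ... + x_M = 0.
   For M = 1 the parameter space is the one-point space R^0, with total mass 1. *)
definition hyperplane_param :: "nat \<Rightarrow> (nat \<Rightarrow> real) \<Rightarrow> nat \<Rightarrow> real" where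
  "hyperplane_param M y = y(M := - (\<Sum>i\<in>{1..M-1}. y i))"

definition A_integral :: "nat \<Rightarrow> ((nat \<Rightarrow> real) \<Rightarrow> real) \<Rightarrow> real" where
  "A_integral M f =
     (LINT y:{y. hyperplane_param M y \<in> A_set M}|(\<Pi>\<^sub>M i\<in>{1..M-1}. lborel). f (hyperplane_param M y))"

end

theory Submission
  imports Defs "HOL-Real_Asymp.Real_Asymp"
begin

text \<open>With \<open>t = \<alpha> / M\<close>, \<open>s = sqrt (2 t)\<close>, \<open>l\<^sub>i = \<lambda>\<^sub>i + M - i\<close> and \<open>X\<^sub>i = (l\<^sub>i - t) / s\<close>, the Charlier
  weight times \<open>s ^ M\<close> is, up to \<open>\<Prod>j<M. 1 / j!\<close>, the product of \<open>2 (X\<^sub>i - X\<^sub>j)\<^sup>2\<close> over \<open>i < j\<close> and of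
  the rescaled Poisson weights \<open>s p\<^sub>t(l\<^sub>i)\<close>. By Stirling's formula \<open>s p\<^sub>t(l\<^sub>i)\<close> tends to
  \<open>exp (- x\<^sub>i\<^sup>2) / sqrt \<pi>\<close>, and it is bounded by a multiple of \<open>exp (- c \<bar>X\<^sub>i\<bar>)\<close> for every \<open>c\<close>.
  Writing the sum over \<open>\<lambda>\<close> as the integral of a step function of \<open>\<lfloor>t + s x\<rfloor>\<close>, dominated convergence
  gives the limit. The measure with fixed sum \<open>N\<close> is the Charlier weight at \<open>\<alpha> = N\<close> restricted to
  \<open>\<Sum>\<lambda>\<^sub>i = N\<close> and divided by the Poisson probability \<open>N ^ N exp (- N) / N!\<close> of that event; here the sum
  runs over \<open>\<lambda>\<^sub>1, \<dots>, \<lambda>\<^sub>M\<^sub>-\<^sub>1\<close>, and the lost factor \<open>s\<close> against \<open>N! exp N / N ^ N\<close> leaves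
  \<open>sqrt (\<pi> M)\<close>.\<close>

subsection \<open>Poisson weights\<close>

lemma stirling_convergent:
  "convergent (\<lambda>n. ln (fact n) - ((real n + 1/2) * ln (real n) - real n))"
proof -
  define b where "b n = ln (fact n) - ((real n + 1/2) * ln (real n) - real n)" for n :: nat
  \<comment> \<open>Differences are taken from index 1 on, so that no logarithm of 0 enters.\<close>
  have diff: "b (Suc (Suc n)) - b (Suc n) = 1 - (real n + 3/2) * ln ((real n + 2) / (real n + 1))" for n
  proof -
    have "ln (fact (Suc (Suc n)) :: real) = ln (real n + 2) + ln (fact (Suc n))"
      unfolding fact_Suc[of "Suc n"] by (subst ln_mult) (auto simp: add.commute)
    then show ?thesis
      unfolding b_def by (simp add: ln_div algebra_simps)
  qed
  \<comment> \<open>The logarithm is expanded about the midpoint \<open>n + 3/2\<close>, where the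
    terms of order 1 and 1/n cancel. The differences are therefore O(1/n^2), hence summable, and
    their partial sums telescope to \<open>b\<close>.\<close>
  have "(\<lambda>n. 1 - (real n + 3/2) * ln ((real n + 2) / (real n + 1))) \<in> O(\<lambda>n. inverse (real n ^ 2))"
    by real_asymp
  then have "(\<lambda>n. b (Suc (Suc n)) - b (Suc n)) \<in> O(\<lambda>n. inverse (real n ^ 2))"
    by (simp only: diff)
  then have "summable (\<lambda>n. b (Suc (Suc n)) - b (Suc n))"
    by (rule summable_comparison_test_bigo[rotated])
       (use inverse_power_summable[of 2, where 'a=real] in simp)
  then have "convergent (\<lambda>n. \<Sum>i<n. b (Suc (Suc i)) - b (Suc i))"
    by (simp add: summable_iff_convergent)
  then have "convergent (\<lambda>n. b (Suc n) - b (Suc 0))"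
    by (simp add: sum_lessThan_telescope[of "\<lambda>n. b (Suc n)"])
  from convergent_add[OF this convergent_const[of "b (Suc 0)"]]
  have "convergent (\<lambda>n. b (Suc n))" by simp
  then have "convergent b"
    by (rule convergent_Suc_iff[THEN iffD1])
  then show ?thesis unfolding b_def .
qed

text \<open>The factorial form of Wallis' partial products lets Stirling's formula be inserted;
  their known limit pi/2 then fixes the Stirling constant.\<close>

lemma wallis_prod_eq:
  "(\<Prod>k=1..n. (4*real k^2) / (4*real k^2 - 1)) =
     2 ^ (4*n) * fact n ^ 4 / ((fact (2*n))\<^sup>2 * (2 * real n + 1))"
proof (induction n)
  case (Suc n)
  have "(\<Prod>k=1..Suc n. (4*real k^2) / (4*real k^2 - 1)) =
     2 ^ (4*n) * fact n ^ 4 / ((fact (2*n))\<^sup>2 * (2 * real n + 1)) *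
     ((4*real (Suc n)^2) / (4*real (Suc n)^2 - 1))"
    using Suc.IH by simp
  also have "4 * real (Suc n)^2 - 1 = (2 * real n + 1) * (2 * real n + 3)"
    by (simp add: power2_eq_square algebra_simps)
  also have "2 ^ (4*n) * fact n ^ 4 / ((fact (2*n))\<^sup>2 * (2 * real n + 1)) *
      ((4*real (Suc n)^2) / ((2 * real n + 1) * (2 * real n + 3))) =
      2 ^ (4 * Suc n) * fact (Suc n) ^ 4 / ((fact (2 * Suc n))\<^sup>2 * (2 * real (Suc n) + 1))"
  proof -
    have f: "fact (2 * Suc n) = (2 * real n + 2) * (2 * real n + 1) * fact (2*n)"
      by (simp add: algebra_simps)
    have g: "2 * real (Suc n) + 1 = 2 * real n + 3" by simp
    have p: "2 ^ (4 * Suc n) = (16::real) * 2 ^ (4 * n)" by (simp add: power_add)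
    have n: "(2 * real n + 1) \<noteq> 0" "2 * real n + 3 \<noteq> 0" "1 + real n \<noteq> 0" "fact (2*n) \<noteq> (0::real)"
      by (auto simp: add_eq_0_iff)
    \<comment> \<open>The induction step as a rational identity in free variables, which keeps the
      simplifier from unfolding factorials and powers.\<close>
    have e: "a * F ^ 4 / (G\<^sup>2 * u) * (4 * m\<^sup>2 / (u * v)) = 16 * a * (m * F) ^ 4 / ((2 * m * u * G)\<^sup>2 * v)"
      if "u \<noteq> 0" "v \<noteq> 0" "m \<noteq> 0" "G \<noteq> 0" for a F G u v m :: real
      using that by (simp add: field_simps power2_eq_square power4_eq_xxxx)
    show ?thesis
      unfolding f g p fact_Suc[of n]
      using e[of "2 * real n + 1" "2 * real n + 3" "1 + real n" "fact (2*n)" "2 ^ (4*n)" "fact n"] n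
      by (simp add: algebra_simps)
  qed
  finally show ?case .
qed simp

text \<open>The limit \<open>L\<close> exists by \<open>stirling_convergent\<close>. Since
  \<open>b n\<close> and \<open>b (2 * n)\<close> have the same limit, Wallis' product tends to exp
  (4 L - 2 L) / 4, and equating this with pi/2 yields \<open>L\<close>.\<close>

lemma ln_fact_stirling:
  "(\<lambda>n. ln (fact n) - ((real n + 1/2) * ln (real n) - real n)) \<longlonglongrightarrow> ln (2 * pi) / 2"
proof -
  define b where "b n = ln (fact n) - ((real n + 1/2) * ln (real n) - real n)" for n :: nat
  obtain L where L: "b \<longlonglongrightarrow> L"
    using stirling_convergent unfolding b_def convergent_def by blast
  have L2: "(\<lambda>n. b (2 * n)) \<longlonglongrightarrow> L"
    by (rule filterlim_compose[OF L]) real_asymp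
  have fb: "fact n = exp (b n) * exp ((real n + 1/2) * ln (real n) - real n)" for n
    by (simp add: b_def flip: exp_add)
  \<comment> \<open>In Wallis' product the powers \<open>n ^ (4 * n)\<close>, the powers of 2 and
    the exponentials from the two Stirling expressions cancel; besides \<open>b\<close> only a
    rational function with limit 1/4 remains.\<close>
  have eq: "exp (4 * b n - 2 * b (2 * n)) * (real n / (2 * (2 * real n + 1))) =
        (\<Prod>k=1..n. (4*real k^2) / (4*real k^2 - 1))" if "n > 0" for n
  proof -
    have f4: "fact n ^ 4 = exp (4 * b n + (4 * real n + 2) * ln (real n) - 4 * real n)"
      unfolding fb[of n] by (simp flip: exp_add exp_of_nat_mult add: algebra_simps)
    have f2: "(fact (2*n))\<^sup>2 = exp (2 * b (2*n) + (4 * real n + 1) * ln (2 * real n) - 4 * real n)"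
      unfolding fb[of "2*n"] by (simp flip: exp_add exp_of_nat_mult add: algebra_simps)
    have "2 ^ (4*n) * fact n ^ 4 / (fact (2*n))\<^sup>2 =
        exp (4 * real n * ln 2) * fact n ^ 4 / (fact (2*n))\<^sup>2"
      by (simp add: exp_of_nat_mult[of "4*n" "ln 2", simplified])
    also have "\<dots> = exp (4 * b n - 2 * b (2 * n) + ln (real n) - ln 2)"
      unfolding f4 f2 using that by (simp add: ln_mult algebra_simps flip: exp_add exp_diff)
    also have "\<dots> = exp (4 * b n - 2 * b (2 * n)) * real n / 2"
      using that by (simp add: exp_diff exp_add)
    finally have A: "2 ^ (4*n) * fact n ^ 4 / (fact (2*n))\<^sup>2 = exp (4 * b n - 2 * b (2 * n)) * real n / 2" .
    have "2 ^ (4*n) * fact n ^ 4 / ((fact (2*n))\<^sup>2 * (2 * real n + 1)) =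
        2 ^ (4*n) * fact n ^ 4 / (fact (2*n))\<^sup>2 / (2 * real n + 1)" by simp
    then show ?thesis
      unfolding wallis_prod_eq A by simp
  qed
  have "(\<lambda>n. exp (4 * b n - 2 * b (2 * n)) * (real n / (2 * (2 * real n + 1)))) \<longlonglongrightarrow> exp (4 * L - 2 * L) * (1/4)"
  proof (rule tendsto_mult)
    show "(\<lambda>n. real n / (2 * (2 * real n + 1))) \<longlonglongrightarrow> 1/4" by real_asymp
  qed (intro tendsto_intros L L2)
  then have "(\<lambda>n. \<Prod>k=1..n. (4*real k^2) / (4*real k^2 - 1)) \<longlonglongrightarrow> exp (4 * L - 2 * L) * (1/4)"
    by (rule Lim_transform_eventually) (intro eventually_mono[OF eventually_gt_at_top[of 0]] eq)
  from LIMSEQ_unique[OF this wallis] have "exp (2 * L) / 4 = pi / 2" by simp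
  then have "ln (exp (2 * L)) = ln (2 * pi)" by simp
  then have "L = ln (2 * pi) / 2" unfolding ln_exp by linarith
  with L show ?thesis unfolding b_def by (simp only:)
qed

text \<open>The quotient is 1 / (\<open>sqrt (2 * n)\<close> \<open>pois n n\<close>), the
  reciprocal of the rescaled Poisson probability of the mean. Conditioning on the sum
  \<open>N\<close> produces this factor, up to \<open>sqrt M\<close>.\<close>

lemma fact_stirling_ratio:
  "(\<lambda>n. fact n * exp (real n) / (real n ^ n * sqrt (2 * real n))) \<longlonglongrightarrow> sqrt pi"
proof -
  have "(\<lambda>n. exp (ln (fact n) - ((real n + 1/2) * ln (real n) - real n) - ln 2 / 2)) \<longlonglongrightarrow> exp (ln (2 * pi) / 2 - ln 2 / 2)"
    by (intro tendsto_intros ln_fact_stirling)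
  also have "exp (ln (2 * pi) / 2 - ln 2 / 2) = exp (ln (sqrt pi))"
    by (simp add: ln_mult ln_sqrt add_divide_distrib del: exp_ln)
  also have "\<dots> = sqrt pi" by simp
  finally show ?thesis
  proof (rule Lim_transform_eventually)
    show "eventually (\<lambda>n. exp (ln (fact n) - ((real n + 1/2) * ln (real n) - real n) - ln 2 / 2) =
        fact n * exp (real n) / (real n ^ n * sqrt (2 * real n))) sequentially"
      using eventually_gt_at_top[of 0]
    proof eventually_elim
      case (elim n)
      have "real n ^ n * sqrt (2 * real n) = exp (real n * ln (real n) + (ln 2 + ln (real n)) / 2)"
      proof -
        have "(ln 2 + ln (real n)) / 2 = ln (sqrt (2 * real n))"
          using elim by (simp add: ln_sqrt ln_mult)
        then have "exp ((ln 2 + ln (real n)) / 2) = sqrt (2 * real n)"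
          using elim by simp
        then show ?thesis
          using elim by (simp add: exp_add exp_of_nat_mult)
      qed
      then show ?case
        by (simp add: exp_diff exp_add algebra_simps add_divide_distrib)
    qed
  qed
qed

section \<open>Local limit and uniform bounds for the Poisson weights\<close>

definition pois :: "real \<Rightarrow> nat \<Rightarrow> real" where
  "pois t k = t ^ k * exp (- t) / fact k"

lemma pois_nonneg: "t \<ge> 0 \<Longrightarrow> pois t k \<ge> 0"
  by (simp add: pois_def)

lemma pois_pos: "t > 0 \<Longrightarrow> pois t k > 0"
  by (simp add: pois_def)

lemma ln_pois: "t > 0 \<Longrightarrow> ln (pois t k) = real k * ln t - t - ln (fact k)"
  by (simp add: pois_def ln_div ln_mult ln_realpow)

text \<open>With u = (k - t) / t, Stirling's formula for k! turns the logarithm of the left side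
  into a convergent part minus t ((1 + u) ln (1 + u) - u). That term is t u^2 h(u) = 2 X^2 h(u), and
  h(u) tends to 1/2 because u tends to 0.\<close>

lemma pois_local_limit:
  fixes t :: "nat \<Rightarrow> real" and k :: "nat \<Rightarrow> nat"
  assumes t: "filterlim t at_top sequentially"
    and k: "(\<lambda>n. (real (k n) - t n) / sqrt (2 * t n)) \<longlonglongrightarrow> x"
  shows "(\<lambda>n. sqrt (2 * t n) * pois (t n) (k n)) \<longlonglongrightarrow> exp (- x\<^sup>2) / sqrt pi"
proof -
  define X where "X n = (real (k n) - t n) / sqrt (2 * t n)" for n
  define u where "u n = (real (k n) - t n) / t n" for n
  \<comment> \<open>The value 1/2 at 0 is the continuous extension, so indices with
    \<open>u n = 0\<close> need no separate treatment.\<close>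
  define h where "h v = (if v = 0 then 1/2 else ((1 + v) * ln (1 + v) - v) / v\<^sup>2)" for v :: real
  define S where "S n = ln (fact n) - ((real n + 1/2) * ln (real n) - real n)" for n :: nat
  have tpos: "eventually (\<lambda>n. t n > 0) sequentially"
    using t by (simp add: filterlim_at_top_dense)
  have X: "X \<longlonglongrightarrow> x" using k unfolding X_def .
  have st: "(\<lambda>n. sqrt 2 / sqrt (t n)) \<longlonglongrightarrow> 0"
    by (rule filterlim_compose[OF _ t]) real_asymp
  have u0: "u \<longlonglongrightarrow> 0"
  proof (rule Lim_transform_eventually)
    show "(\<lambda>n. X n * (sqrt 2 / sqrt (t n))) \<longlonglongrightarrow> 0"
      using tendsto_mult[OF X st] by simp
    show "eventually (\<lambda>n. X n * (sqrt 2 / sqrt (t n)) = u n) sequentially"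
      using tpos by eventually_elim (simp add: X_def u_def real_sqrt_mult)
  qed
  have "(h \<longlongrightarrow> 1/2) (at 0)"
  proof (rule Lim_transform_eventually)
    show "((\<lambda>v::real. ((1 + v) * ln (1 + v) - v) / v\<^sup>2) \<longlongrightarrow> 1/2) (at 0)"
      by real_asymp
    show "eventually (\<lambda>v. ((1 + v) * ln (1 + v) - v) / v\<^sup>2 = h v) (at 0)"
      by (auto simp: h_def eventually_at_filter)
  qed
  then have "isCont h 0" by (simp add: isCont_def h_def)
  then have hu: "(\<lambda>n. h (u n)) \<longlonglongrightarrow> 1/2"
    using isCont_tendsto_compose[OF _ u0] by (fastforce simp: h_def)
  have hh: "(1 + v) * ln (1 + v) - v = v\<^sup>2 * h v" for v
    by (simp add: h_def)
  \<comment> \<open>\<open>k n\<close> is asymptotic to \<open>t n\<close>, so Stirling's formula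
    applies along \<open>k n\<close>.\<close>
  have kt: "filterlim k at_top sequentially"
  proof -
    have "filterlim (\<lambda>n. (1 + u n) * t n) at_top sequentially"
      by (rule filterlim_tendsto_pos_mult_at_top[of _ 1]) (use u0 t in \<open>auto intro!: tendsto_eq_intros\<close>)
    moreover have "eventually (\<lambda>n. (1 + u n) * t n = real (k n)) sequentially"
      using tpos by eventually_elim (simp add: u_def field_simps)
    ultimately have "filterlim (\<lambda>n. real (k n)) at_top sequentially"
      by (simp cong: filterlim_cong)
    then show ?thesis by (simp add: filterlim_sequentially_iff_filterlim_real)
  qed
  have Sk: "(\<lambda>n. S (k n)) \<longlonglongrightarrow> ln (2 * pi) / 2"
    by (rule filterlim_compose[OF _ kt]) (use ln_fact_stirling in \<open>simp add: S_def\<close>)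
  have "(\<lambda>n. ln 2 / 2 - S (k n) - 2 * (X n)\<^sup>2 * h (u n) - ln (1 + u n) / 2)
      \<longlonglongrightarrow> ln 2 / 2 - ln (2 * pi) / 2 - 2 * x\<^sup>2 * (1/2) - ln (1 + 0) / 2"
    by (intro tendsto_intros Sk X hu u0) auto
  from tendsto_exp[OF this]
  have "(\<lambda>n. exp (ln 2 / 2 - S (k n) - 2 * (X n)\<^sup>2 * h (u n) - ln (1 + u n) / 2))
      \<longlonglongrightarrow> exp (- ln pi / 2 - x\<^sup>2)"
    by (simp add: ln_mult add_divide_distrib)
  also have "exp (- ln pi / 2 - x\<^sup>2) = exp (- x\<^sup>2) / sqrt pi"
    by (simp add: exp_diff exp_minus ln_sqrt[symmetric] field_simps)
  finally show ?thesis
  proof (rule Lim_transform_eventually)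
    have "eventually (\<lambda>n. k n > 0) sequentially"
      using kt[unfolded filterlim_at_top, rule_format, of 1] by (auto elim: eventually_mono)
    with tpos show "eventually (\<lambda>n. exp (ln 2 / 2 - S (k n) - 2 * (X n)\<^sup>2 * h (u n) - ln (1 + u n) / 2) =
        sqrt (2 * t n) * pois (t n) (k n)) sequentially"
    proof eventually_elim
      case (elim n)
      have u1: "1 + u n = real (k n) / t n" using elim by (simp add: u_def field_simps)
      have lnu: "ln (1 + u n) = ln (real (k n)) - ln (t n)"
        unfolding u1 using elim by (simp add: ln_div)
      have "2 * (X n)\<^sup>2 * h (u n) = t n * ((u n)\<^sup>2 * h (u n))"
        using elim by (simp add: X_def u_def power_divide power2_eq_square field_simps)
      also have "\<dots> = t n * ((1 + u n) * ln (1 + u n) - u n)"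
        by (simp only: hh)
      also have "\<dots> = real (k n) * ln (1 + u n) - (real (k n) - t n)"
      proof -
        have "t n * (1 + u n) = real (k n)" "t n * u n = real (k n) - t n"
          using elim by (simp_all add: u_def field_simps)
        then show ?thesis by (simp only: right_diff_distrib mult.assoc[symmetric])
      qed
      finally have e: "2 * (X n)\<^sup>2 * h (u n) = real (k n) * ln (1 + u n) - (real (k n) - t n)" .
      have "ln (sqrt (2 * t n) * pois (t n) (k n)) =
          ln 2 / 2 + ln (t n) / 2 + (real (k n) * ln (t n) - t n - ln (fact (k n)))"
        using elim pois_pos[of "t n" "k n"] by (simp add: ln_mult ln_sqrt ln_pois add_divide_distrib)
      also have "\<dots> = ln 2 / 2 - S (k n) - 2 * (X n)\<^sup>2 * h (u n) - ln (1 + u n) / 2"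
        unfolding e lnu S_def by (simp add: algebra_simps diff_divide_distrib)
      finally show ?case
        using elim pois_pos[of "t n" "k n"] by (metis exp_ln mult_pos_pos real_sqrt_gt_zero zero_less_mult_iff zero_less_numeral)
    qed
  qed
qed

text \<open>For fixed k the function \<open>sqrt t * pois t k\<close> of t is largest at t = k +
  1/2. The logarithm of this maximum is \<open>q k\<close>, which converges by Stirling's formula
  and is therefore bounded.\<close>

lemma pois_mode_bound:
  obtains B where "B > 0" "\<And>t k. t > 0 \<Longrightarrow> sqrt t * pois t k \<le> B"
proof -
  define S where "S n = ln (fact n) - ((real n + 1/2) * ln (real n) - real n)" for n :: nat
  define q where "q k = (real k + 1/2) * ln (real k + 1/2) - (real k + 1/2) - ln (fact k)" for k :: nat
  have "(\<lambda>k. ((real k + 1/2) * (ln (real k + 1/2) - ln (real k)) - 1/2) - S k) \<longlonglongrightarrow> 0 - ln (2 * pi) / 2"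
    by (intro tendsto_diff) (use ln_fact_stirling in \<open>simp_all add: S_def\<close>, real_asymp)
  moreover have "((real k + 1/2) * (ln (real k + 1/2) - ln (real k)) - 1/2) - S k = q k" for k
    by (simp add: S_def q_def algebra_simps)
  ultimately have "convergent q" unfolding convergent_def by auto
  then obtain R where R: "\<And>k. \<bar>q k\<bar> \<le> R"
    using convergent_imp_Bseq Bseq_def by (metis real_norm_def)
  show thesis
  proof (rule that)
    show "exp R > 0" by simp
    fix t :: real and k assume t: "t > 0"
    define m where "m = real k + 1/2"
    have m: "m > 0" by (simp add: m_def add_nonneg_pos)
    have "m * ln t - t \<le> m * ln m - m"
    proof -
      have "ln (t / m) \<le> t / m - 1" using t m by (intro ln_le_minus_one) auto
      then have "m * ln (t / m) \<le> t - m" using m by (simp add: field_simps)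
      then show ?thesis using t m by (simp add: ln_div algebra_simps)
    qed
    moreover have "ln (sqrt t * pois t k) = m * ln t - t - ln (fact k)"
      using t pois_pos[OF t, of k] by (simp add: ln_mult ln_sqrt ln_pois m_def algebra_simps)
    ultimately have "ln (sqrt t * pois t k) \<le> q k" by (simp add: q_def m_def)
    then have "ln (sqrt t * pois t k) \<le> R" using R[of k] by simp
    then have "exp (ln (sqrt t * pois t k)) \<le> exp R" by simp
    then show "sqrt t * pois t k \<le> exp R"
      using t pois_pos[OF t, of k] by (simp add: exp_ln)
  qed
qed

text \<open>For d = -e < 0 the claim amounts to (1 - e + e^2) exp e \<ge> 1, which already holds
  with exp e replaced by its quadratic Taylor polynomial. The bound controls the normalisation in
  the tilting argument below.\<close>

lemma exp_le_quadratic: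
  fixes d :: real assumes "\<bar>d\<bar> \<le> 1" shows "exp d \<le> 1 + d + d\<^sup>2"
proof (cases "d \<ge> 0")
  case True then show ?thesis using exp_bound[of d] assms by auto
next
  case False
  define e where "e = - d"
  have e: "e > 0" using False by (simp add: e_def)
  have l: "1 + e + e\<^sup>2 / 2 \<le> exp e" using exp_lower_Taylor_quadratic[of e] e by simp
  have "1 \<le> 1 + e^2/2 + e^3/2 + e^4/2" using e by simp
  also have "\<dots> = (1 - e + e\<^sup>2) * (1 + e + e\<^sup>2 / 2)"
    by (simp add: power2_eq_square power3_eq_cube power4_eq_xxxx field_simps)
  also have "\<dots> \<le> (1 - e + e\<^sup>2) * exp e"
  proof (rule mult_left_mono[OF l])
    show "0 \<le> 1 - e + e\<^sup>2" using assms e by (simp add: e_def)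
  qed
  finally have "exp (-e) \<le> 1 - e + e\<^sup>2" by (simp add: exp_minus field_simps)
  then show ?thesis by (simp add: e_def)
qed

text \<open>Tilting: multiplying the Poisson weight by an exponential in \<open>k\<close> changes the parameter from
  \<open>t\<close> to \<open>t * exp d\<close>, and the normalisation stays bounded for \<open>d\<close> of order \<open>1 / sqrt t\<close>.\<close>

lemma pois_exp_bound:
  fixes c :: real
  assumes c: "c \<ge> 0"
  obtains K where "K > 0" "\<And>t k. t \<ge> 1 \<Longrightarrow> t \<ge> c\<^sup>2 \<Longrightarrow>
     sqrt (2 * t) * pois t k \<le> K * exp (- (c * \<bar>(real k - t) / sqrt (2 * t)\<bar>))"
proof -
  obtain B where B: "B > 0" "\<And>t k. t > 0 \<Longrightarrow> sqrt t * pois t k \<le> B"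
    using pois_mode_bound by blast
  have tilt: "sqrt (2 * t) * pois t k * exp (d * (real k - t)) \<le> sqrt 2 * exp 1 * B * exp (c\<^sup>2 / 2)"
    if t: "t \<ge> 1" "t \<ge> c\<^sup>2" and d: "\<bar>d\<bar> = c / sqrt (2 * t)" for t d k
  proof -
    \<comment> \<open>The condition \<open>t \<ge> c\<^sup>2\<close> keeps the tilt \<open>d\<close>
      within [-1, 1], where the quadratic bound on \<open>exp d\<close> is available.\<close>
    have "c \<le> sqrt (2 * t)" using t c by (intro real_le_rsqrt) simp
    then have d1: "\<bar>d\<bar> \<le> 1" using d t by simp
    have td: "t * d\<^sup>2 = c\<^sup>2 / 2"
    proof -
      have "d\<^sup>2 = (c / sqrt (2 * t))\<^sup>2" using d by (metis power2_abs)
      then show ?thesis using t by (simp add: power_divide)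
    qed
    define t' where "t' = t * exp d"
    have t': "t' > 0" using t by (simp add: t'_def)
    \<comment> \<open>The factor \<open>exp (d * k)\<close> is absorbed into the parameter; what is
      left does not depend on k and has exponent at most t d^2 = c^2 / 2.\<close>
    have "pois t k * exp (d * (real k - t)) = pois t' k * exp (t' - t - d * t)"
      by (simp add: pois_def t'_def power_mult_distrib exp_diff exp_minus exp_add
          exp_of_nat_mult[symmetric] field_simps)
    also have "\<dots> \<le> pois t' k * exp (c\<^sup>2 / 2)"
    proof -
      have "t' - t - d * t = t * (exp d - 1 - d)" by (simp add: t'_def algebra_simps)
      also have "\<dots> \<le> t * d\<^sup>2" using exp_le_quadratic[OF d1] t by (intro mult_left_mono) auto
      finally show ?thesis using td pois_nonneg[of t' k] t' by (intro mult_left_mono) auto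
    qed
    finally have 1: "pois t k * exp (d * (real k - t)) \<le> pois t' k * exp (c\<^sup>2 / 2)" .
    \<comment> \<open>The prefactor is changed to \<open>sqrt t'\<close> at the cost of a constant,
      so that the mode bound can be used at the tilted parameter.\<close>
    have "sqrt (2 * t) = sqrt 2 * (exp (- d / 2) * sqrt t')"
    proof -
      have "exp (- d / 2) = sqrt (exp (- d))"
        by (simp add: real_sqrt_unique[symmetric] power2_eq_square flip: exp_add)
      then show ?thesis
        by (simp add: t'_def flip: real_sqrt_mult) (simp add: exp_minus)
    qed
    also have "\<dots> \<le> sqrt 2 * (exp 1 * sqrt t')"
      using d1 t' by (intro mult_left_mono mult_right_mono) auto
    finally have 2: "sqrt (2 * t) \<le> sqrt 2 * exp 1 * sqrt t'" by simp
    have "sqrt (2 * t) * (pois t k * exp (d * (real k - t))) \<le>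
        sqrt 2 * exp 1 * sqrt t' * (pois t' k * exp (c\<^sup>2 / 2))"
      by (rule mult_mono[OF 2 1]) (use t t' pois_nonneg[of t k] in auto)
    also have "\<dots> = sqrt 2 * exp 1 * (sqrt t' * pois t' k) * exp (c\<^sup>2 / 2)" by simp
    also have "\<dots> \<le> sqrt 2 * exp 1 * B * exp (c\<^sup>2 / 2)"
      using B(2)[OF t'] by (intro mult_left_mono mult_right_mono) auto
    finally show ?thesis by (simp add: mult.assoc)
  qed
  show thesis
  proof (rule that)
    show "sqrt 2 * exp 1 * B * exp (c\<^sup>2 / 2) > 0" using B by simp
    fix t k assume t: "t \<ge> 1" "t \<ge> c\<^sup>2"
    \<comment> \<open>The tilt has the sign of \<open>k - t\<close>, which turns the linear exponent
      into an absolute value and covers both tails.\<close>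
    define d where "d = (if real k \<ge> t then c / sqrt (2 * t) else - c / sqrt (2 * t))"
    have "\<bar>d\<bar> = c / sqrt (2 * t)" using c t by (simp add: d_def)
    from tilt[OF t this, of k]
    have "sqrt (2 * t) * pois t k * exp (d * (real k - t)) \<le> sqrt 2 * exp 1 * B * exp (c\<^sup>2 / 2)" .
    moreover have "d * (real k - t) = c * \<bar>(real k - t) / sqrt (2 * t)\<bar>"
      using t by (simp add: d_def field_simps)
    ultimately show "sqrt (2 * t) * pois t k \<le>
        sqrt 2 * exp 1 * B * exp (c\<^sup>2 / 2) * exp (- (c * \<bar>(real k - t) / sqrt (2 * t)\<bar>))"
      by (simp add: exp_minus field_simps)
  qed
qed

subsection \<open>The rescaled summand\<close>

text \<open>The Charlier probability divided by the volume of a cell of the rescaled lattice, whose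
  spacing is 1 / \<open>sqrt (2 * \<alpha> / M)\<close>: the height of the step density
  approximating the GUE density.\<close>

definition scaled_weight :: "nat \<Rightarrow> real \<Rightarrow> (nat \<Rightarrow> nat) \<Rightarrow> real" where
  "scaled_weight M \<alpha> l = sqrt (2 * \<alpha> / real M) ^ M *
     ((\<Prod>j\<in>{1..M-1}. 1 / fact j) * (V M l)\<^sup>2 * W M l *
        (\<Prod>i\<in>{1..M}. (\<alpha> / real M) ^ l i * exp (- \<alpha> / real M)))"

text \<open>In the shifted coordinates l_i + M - i the product \<open>V\<close> is a Vandermonde
  product and \<open>W\<close> supplies the Poisson factorials. Each of the M - i pairs (i, j)
  yields s^2 = 2 t; the resulting t^(M - i) raises t^(l_i) to the exponent that the Poisson weight
  requires.\<close>

lemma scaled_weight_eq: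
  fixes M :: nat and \<alpha> :: real and l :: "nat \<Rightarrow> nat"
  defines "s \<equiv> sqrt (2 * \<alpha> / real M)"
  defines "X \<equiv> (\<lambda>i. (real (l i + M - i) - \<alpha> / real M) / s)"
  assumes M: "M \<ge> 1" and \<alpha>: "\<alpha> > 0"
  shows "scaled_weight M \<alpha> l = (\<Prod>j\<in>{1..M-1}. 1 / fact j) *
     (\<Prod>i\<in>{1..M}. \<Prod>j\<in>{i<..M}. 2 * (X i - X j)\<^sup>2) *
     (\<Prod>i\<in>{1..M}. s * pois (\<alpha> / real M) (l i + M - i))"
proof -
  define t where "t = \<alpha> / real M"
  have t: "t > 0" using M \<alpha> by (simp add: t_def)
  have s2: "s\<^sup>2 = 2 * t" using t by (simp add: s_def t_def)
  have s: "s > 0" using t by (simp add: s_def t_def)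
  have X: "X i = (real (l i + M - i) - t) / s" for i by (simp add: X_def t_def)
  have "(V M l)\<^sup>2 = (\<Prod>i\<in>{1..M}. \<Prod>j\<in>{i<..M}. t * (2 * (X i - X j)\<^sup>2))"
    unfolding V_def prod_power_distrib
  proof (intro prod.cong refl)
    fix i j assume "i \<in> {1..M}" "j \<in> {i<..M}"
    then have "X i - X j = (real (l i) - real (l j) + real j - real i) / s"
      by (simp add: X of_nat_diff flip: diff_divide_distrib)
    then have "real (l i) - real (l j) + real j - real i = s * (X i - X j)"
      using s by simp
    then show "(real (l i) - real (l j) + real j - real i)\<^sup>2 = t * (2 * (X i - X j)\<^sup>2)"
      by (simp add: power_mult_distrib s2)
  qed
  also have "\<dots> = (\<Prod>i\<in>{1..M}. t ^ (M - i)) * (\<Prod>i\<in>{1..M}. \<Prod>j\<in>{i<..M}. 2 * (X i - X j)\<^sup>2)"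
    by (simp add: prod.distrib)
  finally have V: "(V M l)\<^sup>2 = (\<Prod>i\<in>{1..M}. t ^ (M - i)) * (\<Prod>i\<in>{1..M}. \<Prod>j\<in>{i<..M}. 2 * (X i - X j)\<^sup>2)" .
  define w where "w i = (1 / fact (l i + M - i) :: real)" for i
  have "(\<Prod>i\<in>{1..M}. t ^ (M - i)) * (s ^ M * W M l * (\<Prod>i\<in>{1..M}. t ^ l i * exp (- t))) =
      (\<Prod>i\<in>{1..M}. t ^ (M - i) * (s * w i * (t ^ l i * exp (- t))))"
    by (simp add: W_def prod.distrib flip: w_def)
  also have "\<dots> = (\<Prod>i\<in>{1..M}. s * pois t (l i + M - i))"
  proof (intro prod.cong refl)
    fix i assume "i \<in> {1..M}"
    then have "t ^ (l i + M - i) = t ^ (M - i) * t ^ l i"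
      by (simp flip: power_add add: add.commute)
    then show "t ^ (M - i) * (s * w i * (t ^ l i * exp (- t))) = s * pois t (l i + M - i)"
      by (simp add: pois_def w_def)
  qed
  finally have W: "(\<Prod>i\<in>{1..M}. t ^ (M - i)) * (s ^ M * W M l * (\<Prod>i\<in>{1..M}. t ^ l i * exp (- t))) =
    (\<Prod>i\<in>{1..M}. s * pois t (l i + M - i))" .
  show ?thesis
    unfolding scaled_weight_def V s_def[symmetric]
    unfolding t_def[symmetric] minus_divide_left[symmetric] W[symmetric]
    by (simp add: mult_ac)
qed

text \<open>The right side is what \<open>scaled_weight_eq\<close> becomes in the limit. The M (M -
  1) / 2 factors 2 account for the powers of 2 in \<open>Z_GUE\<close>, and M! compensates for the
  factor j = M in its product of factorials.\<close>

lemma fact_phi_GUE_eq: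
  assumes M: "M \<ge> 1"
  shows "fact M * phi_GUE M x = (\<Prod>j\<in>{1..M-1}. 1 / fact j) *
     (\<Prod>i\<in>{1..M}. \<Prod>j\<in>{i<..M}. 2 * (x i - x j)\<^sup>2) *
     (\<Prod>i\<in>{1..M}. exp (- (x i)\<^sup>2) / sqrt pi)"
proof -
  have "real (\<Sum>i=1..M. M - i) = (\<Sum>i=1..M. real M - real i)"
    by (simp add: of_nat_diff)
  also have "\<dots> = real M * real M - real M * (real M + 1) / 2"
  proof -
    have "(\<Sum>i=1..m. real i) = real m * (real m + 1) / 2" for m
      by (induction m) (auto simp: field_simps)
    then show ?thesis by (simp add: sum_subtractf)
  qed
  also have "\<dots> = (real M)\<^sup>2 / 2 - real M / 2"
    by (simp add: power2_eq_square field_simps)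
  finally have e: "real (\<Sum>i=1..M. M - i) = (real M)\<^sup>2 / 2 - real M / 2" .
  have "(\<Prod>i\<in>{1..M}. \<Prod>j\<in>{i<..M}. 2) = (2::real) ^ (\<Sum>i=1..M. M - i)"
    by (simp add: power_sum)
  also have "\<dots> = 2 powr ((real M)\<^sup>2 / 2 - real M / 2)"
    unfolding e[symmetric] by (simp add: powr_realpow del: of_nat_sum)
  finally have p2: "(\<Prod>i\<in>{1..M}. \<Prod>j\<in>{i<..M}. 2) = (2::real) powr ((real M)\<^sup>2 / 2 - real M / 2)" .
  have f: "(\<Prod>j\<in>{1..M}. fact j) = (\<Prod>j\<in>{1..M-1}. fact j) * (fact M :: real)"
  proof -
    have "{1..M} = insert M {1..M-1}" using M by auto
    then show ?thesis using M by (simp add: mult.commute)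
  qed
  have sp: "sqrt pi ^ M = pi powr (real M / 2)"
    by (simp add: powr_half_sqrt[symmetric] powr_power)
  have "fact M / Z_GUE M = (\<Prod>j\<in>{1..M-1}. 1 / fact j) * (\<Prod>i\<in>{1..M}. \<Prod>j\<in>{i<..M}. 2) / sqrt pi ^ M"
  proof -
    have "2 powr ((real M)\<^sup>2 / 2 - real M / 2) * (2 powr (real M / 2) * 2 powr (- ((real M)\<^sup>2 / 2))) = (1::real)"
      by (simp flip: powr_add)
    \<comment> \<open>Applied with \<open>a\<close> = M!, \<open>b\<close> and \<open>v\<close> the
      powers of 2 in \<open>Z_GUE\<close>, \<open>u\<close> the power of pi, \<open>p\<close> the
      product of the smaller factorials and \<open>w\<close> the power of 2 from the pairs.\<close>
    moreover have e2: "a / (b * u * v * (p * a)) = (1 / p) * w / u"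
      if "w * (b * v) = 1" "a > 0" "u > 0" "p > 0" for a b u v p w :: real
    proof -
      have "b * v \<noteq> 0" using that by auto
      then have "w = 1 / (b * v)" using that by (simp add: field_simps)
      then show ?thesis using that by simp
    qed
    ultimately have "fact M / (2 powr (real M / 2) * pi powr (real M / 2) * 2 powr (- ((real M)\<^sup>2 / 2)) *
        ((\<Prod>j\<in>{1..M-1}. fact j) * fact M)) =
        (1 / (\<Prod>j\<in>{1..M-1}. fact j)) * 2 powr ((real M)\<^sup>2 / 2 - real M / 2) / pi powr (real M / 2)"
      by (intro e2) (auto intro: prod_pos)
    moreover have "(\<Prod>j\<in>{1..M-1}. 1 / fact j) = (1 / (\<Prod>j\<in>{1..M-1}. fact j) :: real)"
      by (simp add: prod_dividef)
    ultimately show ?thesis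
      unfolding Z_GUE_def f p2 sp by (simp only: powr_mult)
  qed
  moreover have "fact M * phi_GUE M x = fact M / Z_GUE M *
      (\<Prod>i\<in>{1..M}. \<Prod>j\<in>{i<..M}. (x i - x j)\<^sup>2) * (\<Prod>i\<in>{1..M}. exp (- (x i)\<^sup>2))"
    by (simp add: phi_GUE_def)
  moreover have "(\<Prod>i\<in>{1..M}. \<Prod>j\<in>{i<..M}. 2 * (x i - x j)\<^sup>2) =
      (\<Prod>i\<in>{1..M}. \<Prod>j\<in>{i<..M}. 2) * (\<Prod>i\<in>{1..M}. \<Prod>j\<in>{i<..M}. (x i - x j)\<^sup>2)"
    by (simp only: prod.distrib)
  moreover have "(\<Prod>i\<in>{1..M}. exp (- (x i)\<^sup>2) / sqrt pi) = (\<Prod>i\<in>{1..M}. exp (- (x i)\<^sup>2)) / sqrt pi ^ M"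
    by (simp add: prod_dividef)
  ultimately show ?thesis by (simp only: times_divide_eq_left times_divide_eq_right mult_ac)
qed

text \<open>Extended by zero to all integer vectors, so that sums run over a full lattice and
  rounded points \<open>\<lfloor>t + s * x i\<rfloor>\<close> are admissible arguments even when
  negative or unordered.\<close>

definition lattice_term :: "nat \<Rightarrow> ((nat \<Rightarrow> real) \<Rightarrow> real) \<Rightarrow> real \<Rightarrow> (nat \<Rightarrow> int) \<Rightarrow> real" where
  "lattice_term M g \<alpha> k =
     (if (\<forall>i\<in>{1..M}. 0 \<le> k i) \<and> (\<forall>i\<in>{1..M}. \<forall>j\<in>{1..M}. i \<le> j \<longrightarrow> k j \<le> k i)
      then scaled_weight M \<alpha> (\<lambda>i\<in>{1..M}. nat (k i)) * g (rescale M \<alpha> (\<lambda>i\<in>{1..M}. nat (k i))) else 0)"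

text \<open>Inside the chamber the ordering of \<kappa> holds eventually, and if x_i < x_j for some
  i < j it fails eventually. On a wall x_i = x_j it may hold for some n and fail for others, but
  \<open>phi_GUE\<close> vanishes there, so the limit is 0 either way and convergence holds at every
  point.\<close>

lemma lattice_term_limit:
  fixes M :: nat and \<alpha> :: "nat \<Rightarrow> real" and \<kappa> :: "nat \<Rightarrow> nat \<Rightarrow> int"
  assumes M: "M \<ge> 1"
    and cont: "continuous_map (product_topology (\<lambda>_. euclideanreal) {1..M}) euclideanreal g"
    and \<alpha>: "filterlim \<alpha> at_top sequentially"
    and x: "x \<in> {1..M} \<rightarrow>\<^sub>E UNIV"
    and \<kappa>: "\<And>i. i \<in> {1..M} \<Longrightarrow> (\<lambda>n. (of_int (\<kappa> n i) - \<alpha> n / real M) / sqrt (2 * \<alpha> n / real M)) \<longlonglongrightarrow> x i"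
  shows "(\<lambda>n. lattice_term M g (\<alpha> n) (\<kappa> n)) \<longlonglongrightarrow> indicator (chamber M) x * (fact M * (g x * phi_GUE M x))"
proof -
  define t where "t n = \<alpha> n / real M" for n
  define s where "s n = sqrt (2 * t n)" for n
  have s': "sqrt (2 * \<alpha> n / real M) = s n" for n by (simp add: s_def t_def)
  have tt: "filterlim t at_top sequentially"
    unfolding t_def divide_inverse using M
    by (intro filterlim_at_top_mult_tendsto_pos[OF tendsto_const _ \<alpha>]) auto
  have ss: "filterlim s at_top sequentially"
    unfolding s_def
    by (intro filterlim_compose[OF sqrt_at_top] filterlim_tendsto_pos_mult_at_top[OF tendsto_const _ tt]) auto
  have \<alpha>pos: "eventually (\<lambda>n. \<alpha> n > 0) sequentially" using \<alpha> by (simp add: filterlim_at_top_dense)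
  have spos: "eventually (\<lambda>n. s n > 0) sequentially" using ss by (simp add: filterlim_at_top_dense)
  define Y where "Y n i = (of_int (\<kappa> n i) - t n) / s n" for n i
  have Y: "(\<lambda>n. Y n i) \<longlonglongrightarrow> x i" if "i \<in> {1..M}" for i
    using \<kappa>[OF that] unfolding Y_def t_def[symmetric] s' .
  \<comment> \<open>The centre t = s^2 / 2 outgrows the fluctuation s Y.\<close>
  have nonneg: "eventually (\<lambda>n. \<forall>i\<in>{1..M}. 0 \<le> \<kappa> n i) sequentially"
  proof (intro eventually_ball_finite ballI)
    fix i assume i: "i \<in> {1..M}"
    have "(\<lambda>n. Y n i / s n) \<longlonglongrightarrow> 0"
      by (rule real_tendsto_divide_at_top[OF Y[OF i] ss])
    then have "eventually (\<lambda>n. Y n i / s n > - (1/2)) sequentially"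
      by (rule order_tendstoD) simp
    with spos show "eventually (\<lambda>n. 0 \<le> \<kappa> n i) sequentially"
    proof eventually_elim
      case (elim n)
      have "s n * s n = 2 * t n" using elim by (simp add: s_def)
      moreover have "of_int (\<kappa> n i) = s n * Y n i + t n"
        using elim by (simp add: Y_def)
      moreover have "s n * s n * (Y n i / s n + 1/2) = s n * Y n i + s n * s n / 2"
        using elim(1) by (simp add: distrib_left)
      ultimately have "of_int (\<kappa> n i) = s n * s n * (Y n i / s n + 1/2)" by simp
      also have "\<dots> > 0" using elim by (intro mult_pos_pos) auto
      finally show ?case by simp
    qed
  qed simp
  define l where "l n = (\<lambda>i\<in>{1..M}. nat (\<kappa> n i))" for n
  define X where "X n i = (real (l n i + M - i) - t n) / s n" for n i
  define E where "E n = (\<Prod>j\<in>{1..M-1}. 1 / fact j) *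
     (\<Prod>i\<in>{1..M}. \<Prod>j\<in>{i<..M}. 2 * (X n i - X n j)\<^sup>2) *
     (\<Prod>i\<in>{1..M}. s n * pois (t n) (l n i + M - i)) * g (rescale M (\<alpha> n) (l n))" for n
  define D where "D n \<longleftrightarrow> (\<forall>i\<in>{1..M}. \<forall>j\<in>{1..M}. i \<le> j \<longrightarrow> \<kappa> n j \<le> \<kappa> n i)" for n
  have eq: "eventually (\<lambda>n. lattice_term M g (\<alpha> n) (\<kappa> n) = (if D n then E n else 0)) sequentially"
    using nonneg \<alpha>pos
  proof eventually_elim
    case (elim n)
    show ?case
      using elim unfolding lattice_term_def l_def[symmetric] D_def[symmetric] E_def
      by (simp add: scaled_weight_eq[OF M] s' X_def t_def)
  qed
  \<comment> \<open>The weights involve the shifted coordinates \<open>X\<close>, while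
    \<open>g\<close> is evaluated at the unshifted \<open>Y\<close>. The shift M - i is negligible
    against \<open>s\<close>, so both tend to \<open>x\<close>.\<close>
  have X: "(\<lambda>n. X n i) \<longlonglongrightarrow> x i" if i: "i \<in> {1..M}" for i
  proof (rule Lim_transform_eventually)
    have "(\<lambda>n. (real M - real i) / s n) \<longlonglongrightarrow> 0"
      by (rule real_tendsto_divide_at_top[OF tendsto_const ss])
    from tendsto_add[OF Y[OF i] this]
    show "(\<lambda>n. Y n i + (real M - real i) / s n) \<longlonglongrightarrow> x i" by simp
    show "eventually (\<lambda>n. Y n i + (real M - real i) / s n = X n i) sequentially"
      using nonneg by eventually_elim (use i in \<open>simp add: Y_def X_def l_def of_nat_diff flip: add_divide_distrib\<close>)
  qed
  have glim: "(\<lambda>n. g (rescale M (\<alpha> n) (l n))) \<longlonglongrightarrow> g x"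
  proof -
    have "limitin (product_topology (\<lambda>_. euclideanreal) {1..M}) (\<lambda>n. rescale M (\<alpha> n) (l n)) x sequentially"
      unfolding limitin_componentwise
    proof (intro conjI ballI)
      show "x \<in> extensional {1..M}" using x by (simp add: PiE_iff)
      show "eventually (\<lambda>n. rescale M (\<alpha> n) (l n) \<in> topspace (product_topology (\<lambda>_. euclideanreal) {1..M})) sequentially"
        by (simp add: rescale_def)
      fix i assume i: "i \<in> {1..M}"
      have "(\<lambda>n. rescale M (\<alpha> n) (l n) i) \<longlonglongrightarrow> x i"
        by (rule Lim_transform_eventually[OF Y[OF i]], use nonneg in eventually_elim)
           (use i in \<open>simp add: rescale_def Y_def l_def s' t_def\<close>)
      then show "limitin euclideanreal (\<lambda>n. rescale M (\<alpha> n) (l n) i) (x i) sequentially" by simp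
    qed
    from continuous_map_limit[OF cont this] show ?thesis by (simp add: o_def)
  qed
  have Elim: "E \<longlonglongrightarrow> fact M * (g x * phi_GUE M x)"
  proof -
    have "E \<longlonglongrightarrow> (\<Prod>j\<in>{1..M-1}. 1 / fact j) *
     (\<Prod>i\<in>{1..M}. \<Prod>j\<in>{i<..M}. 2 * (x i - x j)\<^sup>2) *
     (\<Prod>i\<in>{1..M}. exp (- (x i)\<^sup>2) / sqrt pi) * g x"
      unfolding E_def
    proof (intro tendsto_mult tendsto_prod tendsto_const tendsto_power tendsto_diff glim X)
      fix i assume i: "i \<in> {1..M}"
      show "(\<lambda>n. s n * pois (t n) (l n i + M - i)) \<longlonglongrightarrow> exp (- (x i)\<^sup>2) / sqrt pi"
        unfolding s_def by (rule pois_local_limit[OF tt]) (use X[OF i] in \<open>simp add: X_def s_def\<close>)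
    qed auto
    then have "E \<longlonglongrightarrow> fact M * phi_GUE M x * g x"
      by (simp only: fact_phi_GUE_eq[OF M])
    then show ?thesis by (simp only: mult_ac)
  qed
  have less: "eventually (\<lambda>n. \<kappa> n j < \<kappa> n i) sequentially" if "i \<in> {1..M}" "j \<in> {1..M}" "x j < x i" for i j
  proof -
    have "(\<lambda>n. Y n i - Y n j) \<longlonglongrightarrow> x i - x j" by (intro tendsto_diff Y that)
    then have "eventually (\<lambda>n. Y n i - Y n j > 0) sequentially"
      by (rule order_tendstoD) (use that in simp)
    with spos show ?thesis
      by eventually_elim (simp add: Y_def field_simps)
  qed
  have "(\<lambda>n. if D n then E n else 0) \<longlonglongrightarrow> indicator (chamber M) x * (fact M * (g x * phi_GUE M x))"
  proof (cases "x \<in> chamber M")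
    case True
    have "eventually (\<lambda>n. \<forall>i\<in>{1..M}. \<forall>j\<in>{1..M}. i \<le> j \<longrightarrow> \<kappa> n j \<le> \<kappa> n i) sequentially"
    proof (intro eventually_ball_finite ballI)
      fix i j assume ij: "i \<in> {1..M}" "j \<in> {1..M}"
      show "eventually (\<lambda>n. i \<le> j \<longrightarrow> \<kappa> n j \<le> \<kappa> n i) sequentially"
      proof (cases "i < j")
        case True
        then have "x j < x i" using \<open>x \<in> chamber M\<close> ij by (auto simp: chamber_def)
        from less[OF ij this] show ?thesis by eventually_elim auto
      qed (auto simp: not_less order.antisym)
    qed auto
    then have "eventually (\<lambda>n. E n = (if D n then E n else 0)) sequentially"
      by eventually_elim (simp add: D_def)
    from Lim_transform_eventually[OF Elim this] show ?thesis using True by simp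
  next
    case False
    then obtain i j where ij: "i \<in> {1..M}" "j \<in> {1..M}" "i < j" "x i \<le> x j"
      using x by (auto simp: chamber_def not_less)
    show ?thesis
    proof (cases "x i = x j")
      case True
      then have "phi_GUE M x = 0"
      proof -
        have z: "(\<Prod>j\<in>{i<..M}. (x i - x j)\<^sup>2) = 0"
          by (rule prod_zero[OF _ bexI[of _ j]]) (use ij True in auto)
        have "(\<Prod>i\<in>{1..M}. \<Prod>j\<in>{i<..M}. (x i - x j)\<^sup>2) = 0"
        proof (rule prod_zero)
          show "\<exists>i\<in>{1..M}. (\<Prod>j\<in>{i<..M}. (x i - x j)\<^sup>2) = 0"
            by (rule bexI[of _ i]) (use z ij in auto)
        qed simp
        then show ?thesis by (simp only: phi_GUE_def mult_zero_right mult_zero_left)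
      qed
      then have "E \<longlonglongrightarrow> 0" using Elim by simp
      then have "(\<lambda>n. if D n then E n else 0) \<longlonglongrightarrow> 0"
        by (rule tendsto_0_le[where K = 1]) auto
      then show ?thesis using False by simp
    next
      case ne: False
      then have "eventually (\<lambda>n. \<kappa> n i < \<kappa> n j) sequentially"
        using ij by (intro less) auto
      then have "eventually (\<lambda>n. 0 = (if D n then E n else 0)) sequentially"
        proof eventually_elim
          case (elim n)
          have "\<kappa> n j \<le> \<kappa> n i" if "D n"
            using that[unfolded D_def, rule_format, OF ij(1,2)] ij(3) by simp
          with elim show ?case by auto
        qed
      from Lim_transform_eventually[OF tendsto_const this] show ?thesis using False by simp
    qed
  qed
  then show ?thesis
    by (rule Lim_transform_eventually) (use eq in \<open>auto elim: eventually_mono\<close>)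
qed

text \<open>With S the sum of the |Y_i|, the Vandermonde factor and \<open>g\<close> grow at most
  exponentially in S, while the Poisson weights decay exponentially at any prescribed rate. The
  result is a majorant uniform in large \<alpha>.\<close>

lemma lattice_term_bound:
  fixes M :: nat and C c :: real
  assumes M: "M \<ge> 1"
    and growth: "\<And>x. x \<in> {1..M} \<rightarrow>\<^sub>E UNIV \<Longrightarrow> \<bar>g x\<bar> \<le> C * exp (c * (\<Sum>i=1..M. \<bar>x i\<bar>))"
  shows "\<exists>K T. T > 0 \<and> (\<forall>\<alpha>\<ge>T. \<forall>k. \<bar>lattice_term M g \<alpha> k\<bar> \<le>
     K * exp (- (\<Sum>i=1..M. \<bar>(of_int (k i) - \<alpha> / real M) / sqrt (2 * \<alpha> / real M)\<bar>)))"
proof -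
  \<comment> \<open>The rate pays \<open>4 * M\<^sup>2\<close> for the Vandermonde factor and
    \<open>\<bar>c\<bar>\<close> for \<open>g\<close>; the remaining 1 leaves exp (- S).\<close>
  define c' where "c' = 4 * real M ^ 2 + \<bar>c\<bar> + 1"
  have c': "c' \<ge> 0" by (simp add: c'_def)
  obtain K0 where K0: "K0 > 0" "\<And>t k. t \<ge> 1 \<Longrightarrow> t \<ge> c'\<^sup>2 \<Longrightarrow>
     sqrt (2 * t) * pois t k \<le> K0 * exp (- (c' * \<bar>(real k - t) / sqrt (2 * t)\<bar>))"
    using pois_exp_bound[OF c'] by blast
  \<comment> \<open>The growth bound at the zero vector forces \<open>C \<ge> 0\<close>.\<close>
  have C: "C \<ge> 0"
  proof -
    have "0 \<le> C * exp (c * (\<Sum>i=1..M. \<bar>(\<lambda>i\<in>{1..M}. 0) i\<bar>))"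
      by (rule order_trans[OF abs_ge_zero growth]) (auto simp: PiE_iff extensional_def)
    then show ?thesis by (simp add: zero_le_mult_iff)
  qed
  define P where "P = (\<Prod>j\<in>{1..M-1}. 1 / fact j :: real)"
  have P: "P \<ge> 0" unfolding P_def by (intro prod_nonneg) auto
  define K where "K = P * (2 * exp (4 * real M)) ^ (M * M) * (K0 ^ M * exp (c' * real M ^ 2)) * C"
  show ?thesis
  proof (intro exI conjI allI impI)
    \<comment> \<open>This threshold for \<alpha> means \<open>t \<ge> 1 + c'\<^sup>2\<close>, which
      gives both conditions of the Poisson bound.\<close>
    show "real M * (1 + c'\<^sup>2) > 0" using M by (intro mult_pos_pos) (auto intro: add_pos_nonneg)
    fix \<alpha> :: real and k :: "nat \<Rightarrow> int" assume \<alpha>: "\<alpha> \<ge> real M * (1 + c'\<^sup>2)"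
    define t where "t = \<alpha> / real M"
    define s where "s = sqrt (2 * t)"
    have s': "sqrt (2 * \<alpha> / real M) = s" by (simp add: s_def t_def)
    have t1: "t \<ge> 1 + c'\<^sup>2" using \<alpha> M by (simp add: t_def field_simps)
    then have t: "t \<ge> 1" "t \<ge> c'\<^sup>2" using zero_le_power2[of c'] by linarith+
    have \<alpha>pos: "\<alpha> > 0" using t M unfolding t_def by (metis divide_le_0_iff not_less not_one_le_zero of_nat_0_le_iff order.trans)
    have s: "s \<ge> 1" unfolding s_def using t by simp
    define Y where "Y i = (of_int (k i) - t) / s" for i
    define S where "S = (\<Sum>i=1..M. \<bar>Y i\<bar>)"
    have S: "S \<ge> 0" by (simp add: S_def sum_nonneg)
    have YS: "\<bar>Y i\<bar> \<le> S" if "i \<in> {1..M}" for i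
      unfolding S_def using that by (intro member_le_sum) auto
    show "\<bar>lattice_term M g \<alpha> k\<bar> \<le>
     K * exp (- (\<Sum>i=1..M. \<bar>(of_int (k i) - \<alpha> / real M) / sqrt (2 * \<alpha> / real M)\<bar>))"
    proof (cases "(\<forall>i\<in>{1..M}. 0 \<le> k i) \<and> (\<forall>i\<in>{1..M}. \<forall>j\<in>{1..M}. i \<le> j \<longrightarrow> k j \<le> k i)")
      case True
      define l where "l = (\<lambda>i\<in>{1..M}. nat (k i))"
      define X where "X i = (real (l i + M - i) - t) / s" for i
      have XY: "\<bar>X i - Y i\<bar> \<le> real M" if i: "i \<in> {1..M}" for i
      proof -
        have "X i - Y i = (real M - real i) / s"
          using True i by (simp add: X_def Y_def l_def of_nat_diff flip: diff_divide_distrib)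
        then have "\<bar>X i - Y i\<bar> = (real M - real i) / s"
          using i s by simp
        also have "\<dots> \<le> (real M - real i) / 1"
          using i s by (intro divide_left_mono) auto
        also have "\<dots> \<le> real M" by simp
        finally show ?thesis .
      qed
      have p1: "\<bar>\<Prod>i\<in>{1..M}. \<Prod>j\<in>{i<..M}. 2 * (X i - X j)\<^sup>2\<bar> \<le> (2 * exp (4 * real M)) ^ (M * M) * exp (4 * real M ^ 2 * S)"
      proof -
        \<comment> \<open>From |X_i - X_j| \<le> 2 S + 2 M and y \<le> exp y, \<open>b\<close>
          bounds every factor. As \<open>b \<ge> 1\<close>, the number of factors may be rounded up
          to M^2.\<close>
        define b where "b = 2 * exp (2 * (2 * S + 2 * real M))"
        have "1 \<le> exp (2 * (2 * S + 2 * real M))" using S by simp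
        then have b: "b \<ge> 1" unfolding b_def by linarith
        have 1: "2 * (X i - X j)\<^sup>2 \<le> b" if "i \<in> {1..M}" "j \<in> {1..M}" for i j
        proof -
          have "\<bar>X i - X j\<bar> \<le> 2 * S + 2 * real M"
            using XY[OF that(1)] XY[OF that(2)] YS[OF that(1)] YS[OF that(2)] by linarith
          also have "\<dots> \<le> exp (2 * S + 2 * real M)"
            using exp_ge_add_one_self[of "2 * S + 2 * real M"] by linarith
          finally have "\<bar>X i - X j\<bar>\<^sup>2 \<le> (exp (2 * S + 2 * real M))\<^sup>2"
            by (intro power_mono) auto
          then show ?thesis by (simp add: b_def flip: exp_double)
        qed
        have "\<bar>\<Prod>i\<in>{1..M}. \<Prod>j\<in>{i<..M}. 2 * (X i - X j)\<^sup>2\<bar> =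
            (\<Prod>i\<in>{1..M}. \<Prod>j\<in>{i<..M}. 2 * (X i - X j)\<^sup>2)"
          by (intro abs_of_nonneg prod_nonneg) auto
        also have "\<dots> \<le> (\<Prod>i\<in>{1..M}. b ^ M)"
        proof (intro prod_mono conjI prod_nonneg)
          fix i assume i: "i \<in> {1..M}"
          have "(\<Prod>j\<in>{i<..M}. 2 * (X i - X j)\<^sup>2) \<le> (\<Prod>j\<in>{i<..M}. b)"
            using i by (intro prod_mono conjI 1) auto
          also have "\<dots> = b ^ (M - i)" by simp
          also have "\<dots> \<le> b ^ M" using b by (intro power_increasing) auto
          finally show "(\<Prod>j\<in>{i<..M}. 2 * (X i - X j)\<^sup>2) \<le> b ^ M" .
        qed auto
        also have "\<dots> = b ^ (M * M)" by (simp add: power_mult)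
        also have "b = (2 * exp (4 * real M)) * exp (4 * S)"
          by (simp add: b_def exp_add algebra_simps)
        also have "\<dots> ^ (M * M) = (2 * exp (4 * real M)) ^ (M * M) * exp (4 * real M ^ 2 * S)"
          by (simp only: power_mult_distrib exp_of_nat_mult[symmetric]) (simp add: power2_eq_square mult_ac)
        finally show ?thesis .
      qed
      have p2: "\<bar>\<Prod>i\<in>{1..M}. s * pois t (l i + M - i)\<bar> \<le> K0 ^ M * exp (c' * real M ^ 2) * exp (- (c' * S))"
      proof -
        have "\<bar>\<Prod>i\<in>{1..M}. s * pois t (l i + M - i)\<bar> = (\<Prod>i\<in>{1..M}. s * pois t (l i + M - i))"
          using s t by (intro abs_of_nonneg prod_nonneg) (auto simp: pois_nonneg)
        also have "\<dots> \<le> (\<Prod>i\<in>{1..M}. K0 * exp (c' * real M - c' * \<bar>Y i\<bar>))"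
        proof (intro prod_mono conjI)
          fix i assume i: "i \<in> {1..M}"
          show "0 \<le> s * pois t (l i + M - i)" using s t by (simp add: pois_nonneg)
          have "s * pois t (l i + M - i) \<le> K0 * exp (- (c' * \<bar>X i\<bar>))"
            using K0(2)[OF t, of "l i + M - i"] by (simp add: s_def X_def)
          also have "\<dots> \<le> K0 * exp (c' * real M - c' * \<bar>Y i\<bar>)"
          proof -
            have "\<bar>Y i\<bar> - real M \<le> \<bar>X i\<bar>" using XY[OF i] by linarith
            from mult_left_mono[OF this c'] show ?thesis
              using K0(1) by (simp add: right_diff_distrib)
          qed
          finally show "s * pois t (l i + M - i) \<le> K0 * exp (c' * real M - c' * \<bar>Y i\<bar>)" .
        qed
        also have "\<dots> = K0 ^ M * exp (\<Sum>i\<in>{1..M}. c' * real M - c' * \<bar>Y i\<bar>)"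
          by (simp add: prod.distrib exp_sum)
        also have "(\<Sum>i\<in>{1..M}. c' * real M - c' * \<bar>Y i\<bar>) = c' * real M ^ 2 - c' * S"
          by (simp add: S_def sum_subtractf sum_distrib_left power2_eq_square)
        finally show ?thesis by (simp add: exp_diff exp_minus divide_inverse)
      qed
      have p3: "\<bar>g (rescale M \<alpha> l)\<bar> \<le> C * exp (\<bar>c\<bar> * S)"
      proof -
        have "\<bar>g (rescale M \<alpha> l)\<bar> \<le> C * exp (c * (\<Sum>i=1..M. \<bar>rescale M \<alpha> l i\<bar>))"
          by (rule growth) (simp add: rescale_def)
        also have "(\<Sum>i=1..M. \<bar>rescale M \<alpha> l i\<bar>) = S"
          unfolding S_def using True by (intro sum.cong refl) (simp add: rescale_def l_def Y_def s' t_def)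
        also have "C * exp (c * S) \<le> C * exp (\<bar>c\<bar> * S)"
          using C S by (intro mult_left_mono) (auto intro: mult_right_mono)
        finally show ?thesis .
      qed
      have "lattice_term M g \<alpha> k = P * (\<Prod>i\<in>{1..M}. \<Prod>j\<in>{i<..M}. 2 * (X i - X j)\<^sup>2) *
          (\<Prod>i\<in>{1..M}. s * pois t (l i + M - i)) * g (rescale M \<alpha> l)"
        using True unfolding lattice_term_def l_def[symmetric] P_def
        by (simp add: scaled_weight_eq[OF M \<alpha>pos] s' X_def t_def)
      then have "\<bar>lattice_term M g \<alpha> k\<bar> = P * \<bar>\<Prod>i\<in>{1..M}. \<Prod>j\<in>{i<..M}. 2 * (X i - X j)\<^sup>2\<bar> *
          \<bar>\<Prod>i\<in>{1..M}. s * pois t (l i + M - i)\<bar> * \<bar>g (rescale M \<alpha> l)\<bar>"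
        using P by (simp only: abs_mult abs_of_nonneg)
      also have "\<dots> \<le> P * ((2 * exp (4 * real M)) ^ (M * M) * exp (4 * real M ^ 2 * S)) *
          (K0 ^ M * exp (c' * real M ^ 2) * exp (- (c' * S))) * (C * exp (\<bar>c\<bar> * S))"
        using P K0(1) C by (intro mult_mono p1 p2 p3 order_refl mult_nonneg_nonneg) auto
      also have "\<dots> = K * (exp (4 * real M ^ 2 * S) * exp (- (c' * S)) * exp (\<bar>c\<bar> * S))"
        by (simp add: K_def mult_ac)
      also have "exp (4 * real M ^ 2 * S) * exp (- (c' * S)) * exp (\<bar>c\<bar> * S) = exp (- S)"
        by (simp add: c'_def algebra_simps flip: exp_add)
      finally show ?thesis
        unfolding S_def Y_def t_def s' .
    next
      case False
      have "K \<ge> 0" using P C K0 by (simp add: K_def)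
      with False show ?thesis by (auto simp: lattice_term_def)
    qed
  qed
qed

subsection \<open>Lattice sums as integrals\<close>

lemma measurable_floor_scale:
  fixes t s :: real
  assumes "finite I"
  shows "(\<lambda>x. \<lambda>i\<in>I. \<lfloor>t + s * x i\<rfloor>) \<in> measurable (\<Pi>\<^sub>M i\<in>I. lborel) (count_space (I \<rightarrow>\<^sub>E (UNIV :: int set)))"
proof (subst measurable_count_space_eq_countable)
  show "countable (I \<rightarrow>\<^sub>E (UNIV :: int set))"
    using assms by (intro countable_PiE) auto
  have "(\<lambda>x. \<lambda>i\<in>I. \<lfloor>t + s * x i\<rfloor>) -` {k} \<inter> space (\<Pi>\<^sub>M i\<in>I. lborel) =
      {x \<in> space (\<Pi>\<^sub>M i\<in>I. lborel). \<forall>i\<in>I. \<lfloor>t + s * x i\<rfloor> = k i}"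
    if "k \<in> I \<rightarrow>\<^sub>E (UNIV :: int set)" for k
    using that by (auto simp: restrict_def fun_eq_iff PiE_iff extensional_def)
  moreover have "{x \<in> space (\<Pi>\<^sub>M i\<in>I. lborel). \<forall>i\<in>I. \<lfloor>t + s * x i\<rfloor> = k i} \<in> sets (\<Pi>\<^sub>M i\<in>I. lborel)"
    for k :: "'a \<Rightarrow> int"
    unfolding floor_eq_iff using assms by measurable
  ultimately show "(\<lambda>x. \<lambda>i\<in>I. \<lfloor>t + s * x i\<rfloor>) \<in> space (\<Pi>\<^sub>M i\<in>I. lborel) \<rightarrow> I \<rightarrow>\<^sub>E UNIV \<and>
    (\<forall>k\<in>I \<rightarrow>\<^sub>E UNIV. (\<lambda>x. \<lambda>i\<in>I. \<lfloor>t + s * x i\<rfloor>) -` {k} \<inter> space (\<Pi>\<^sub>M i\<in>I. lborel) \<in> sets (\<Pi>\<^sub>M i\<in>I. lborel))"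
    by auto
qed

text \<open>The points rounded to a given lattice point form a half-open cube of side 1 / s. For
  empty \<open>I\<close> both measures are unit masses at one point, which covers M = 1 in the
  fixed-sum case.\<close>

lemma distr_floor_scale:
  fixes t s :: real
  assumes I: "finite I" and s: "s > 0"
  shows "distr (\<Pi>\<^sub>M i\<in>I. lborel) (count_space (I \<rightarrow>\<^sub>E (UNIV :: int set))) (\<lambda>x. \<lambda>i\<in>I. \<lfloor>t + s * x i\<rfloor>) =
     density (count_space (I \<rightarrow>\<^sub>E UNIV)) (\<lambda>_. ennreal (1 / s ^ card I))" (is "?L = ?R")
proof (rule measure_eqI_countable[where A = "I \<rightarrow>\<^sub>E (UNIV :: int set)"])
  interpret product_sigma_finite "\<lambda>_. lborel :: real measure" ..
  show "countable (I \<rightarrow>\<^sub>E (UNIV :: int set))"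
    using I by (intro countable_PiE) auto
  fix k :: "'a \<Rightarrow> int" assume k: "k \<in> I \<rightarrow>\<^sub>E UNIV"
  have 1: "(\<lambda>x. \<lambda>i\<in>I. \<lfloor>t + s * x i\<rfloor>) -` {k} \<inter> space (\<Pi>\<^sub>M i\<in>I. lborel) =
      (\<Pi>\<^sub>E i\<in>I. {(of_int (k i) - t) / s ..< (of_int (k i) + 1 - t) / s})"
  proof -
    have *: "\<lfloor>t + s * y\<rfloor> = m \<longleftrightarrow> y \<in> {(of_int m - t) / s ..< (of_int m + 1 - t) / s}" for y m
      using s by (auto simp: floor_eq_iff field_simps)
    have "(\<lambda>x. \<lambda>i\<in>I. \<lfloor>t + s * x i\<rfloor>) -` {k} \<inter> space (\<Pi>\<^sub>M i\<in>I. lborel) =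
      {x \<in> space (\<Pi>\<^sub>M i\<in>I. lborel). \<forall>i\<in>I. \<lfloor>t + s * x i\<rfloor> = k i}"
      using k by (auto simp: restrict_def fun_eq_iff PiE_iff extensional_def)
    then show ?thesis
      unfolding * by (auto simp: space_PiM PiE_iff)
  qed
  have "emeasure ?L {k} = (\<Prod>i\<in>I. emeasure lborel {(of_int (k i) - t) / s ..< (of_int (k i) + 1 - t) / s})"
    using k I by (simp add: emeasure_distr[OF measurable_floor_scale] 1 emeasure_PiM)
  also have "\<dots> = (\<Prod>i\<in>I. ennreal (1 / s))"
    using s by (intro prod.cong refl) (simp add: divide_right_mono flip: diff_divide_distrib)
  also have "\<dots> = ennreal (1 / s ^ card I)"
    using s by (simp add: ennreal_power power_one_over)
  also have "\<dots> = emeasure ?R {k}"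
    using k by (simp add: emeasure_density nn_integral_count_space_indicator[symmetric] nn_integral_cmult_indicator)
  finally show "emeasure ?L {k} = emeasure ?R {k}" .
qed auto

text \<open>A change of variables along the rounding map: the lattice sum becomes the integral of a
  step function over a space that does not depend on \<open>t\<close> and \<open>s\<close>.\<close>

lemma integral_count_space_floor:
  fixes F :: "('a \<Rightarrow> int) \<Rightarrow> real" and t s :: real
  assumes I: "finite I" and s: "s > 0"
  shows "integral\<^sup>L (count_space (I \<rightarrow>\<^sub>E UNIV)) F =
     (LINT x|(\<Pi>\<^sub>M i\<in>I. lborel). s ^ card I * F (\<lambda>i\<in>I. \<lfloor>t + s * x i\<rfloor>))"
proof -
  have "(LINT x|(\<Pi>\<^sub>M i\<in>I. lborel). s ^ card I * F (\<lambda>i\<in>I. \<lfloor>t + s * x i\<rfloor>)) =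
     (LINT k|distr (\<Pi>\<^sub>M i\<in>I. lborel) (count_space (I \<rightarrow>\<^sub>E UNIV)) (\<lambda>x. \<lambda>i\<in>I. \<lfloor>t + s * x i\<rfloor>). s ^ card I * F k)"
    by (rule integral_distr[OF measurable_floor_scale[OF I], symmetric]) simp
  also have "\<dots> = integral\<^sup>L (count_space (I \<rightarrow>\<^sub>E UNIV)) F"
    unfolding distr_floor_scale[OF I s] using s by (subst integral_density) auto
  finally show ?thesis ..
qed

text \<open>Serves to move the sums over partitions to sums over integer vectors.\<close>

lemma integral_count_space_inj:
  fixes f :: "'b \<Rightarrow> real"
  assumes h: "inj_on h A" "h ` A \<subseteq> B" and f: "\<And>b. b \<in> B - h ` A \<Longrightarrow> f b = 0"
  shows "(LINT a|count_space A. f (h a)) = integral\<^sup>L (count_space B) f"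
proof -
  have "(LINT a|count_space A. f (h a)) = (LINT b|count_space (h ` A). f b)"
    using h by (intro integral_bij_count_space) (simp add: bij_betw_def)
  also have "\<dots> = (LINT b|restrict_space (count_space B) (h ` A). f b)"
    using h by (simp add: restrict_count_space Int_absorb2)
  also have "\<dots> = (LINT b|count_space B. indicator (h ` A) b *\<^sub>R f b)"
    by (intro integral_restrict_space) simp
  also have "\<dots> = integral\<^sup>L (count_space B) f"
    by (intro Bochner_Integration.integral_cong refl) (use f in \<open>auto split: split_indicator\<close>)
  finally show ?thesis .
qed

lemma integrable_exp_neg_abs: "integrable lborel (\<lambda>x::real. exp (- \<bar>x\<bar>))"
proof -
  have "has_bochner_integral lborel (\<lambda>x::real. indicator {0..} x *\<^sub>R exp (- \<bar>x\<bar>)) 1"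
  proof (rule has_bochner_integral_nn_integral)
    have "(\<integral>\<^sup>+x. ennreal (indicator {0..} x *\<^sub>R exp (- \<bar>x\<bar>)) \<partial>lborel) =
        (\<integral>\<^sup>+x. ennreal (x ^ 0 * exp (- x)) * indicator {0..} x \<partial>lborel)"
      by (intro nn_integral_cong) (auto split: split_indicator)
    then show "(\<integral>\<^sup>+x. ennreal (indicator {0..} x *\<^sub>R exp (- \<bar>x\<bar>)) \<partial>lborel) = ennreal 1"
      by (simp only: nn_intergal_power_times_exp_Ici) simp
  qed auto
  from has_bochner_integral_even_function[OF this] show ?thesis
    by (auto intro: integrable.intros)
qed

lemma floor_scale_error:
  fixes t s x :: real
  assumes s: "s > 0"
  shows "\<bar>(of_int \<lfloor>t + s * x\<rfloor> - t) / s - x\<bar> \<le> 1 / s"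
proof -
  have "(of_int \<lfloor>t + s * x\<rfloor> - t) / s - x = (of_int \<lfloor>t + s * x\<rfloor> - (t + s * x)) / s"
    using s by (simp add: field_simps)
  also have "\<bar>\<dots>\<bar> = \<bar>of_int \<lfloor>t + s * x\<rfloor> - (t + s * x)\<bar> / s" using s by simp
  also have "\<dots> \<le> 1 / s" using s by (intro divide_right_mono) linarith+
  finally show ?thesis .
qed

lemma floor_scale_limit:
  fixes t s :: "nat \<Rightarrow> real"
  assumes s: "filterlim s at_top sequentially"
  shows "(\<lambda>n. (of_int \<lfloor>t n + s n * x\<rfloor> - t n) / s n) \<longlonglongrightarrow> x"
proof (rule LIM_zero_cancel, rule Lim_null_comparison)
  have "eventually (\<lambda>n. s n > 0) sequentially" using s by (simp add: filterlim_at_top_dense)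
  then show "eventually (\<lambda>n. norm ((of_int \<lfloor>t n + s n * x\<rfloor> - t n) / s n - x) \<le> 1 / s n) sequentially"
    by eventually_elim (use floor_scale_error in simp)
  show "(\<lambda>n. 1 / s n) \<longlonglongrightarrow> 0" by (rule real_tendsto_divide_at_top[OF tendsto_const s])
qed

text \<open>Dominated convergence for the step functions. The assumed bound is in terms of the
  rounded point; as rounding moves a coordinate by at most 1 / s \<le> 1, it becomes a fixed
  integrable majorant at the cost of a factor e per coordinate.\<close>

lemma lattice_sum_limit:
  fixes F :: "nat \<Rightarrow> ('a \<Rightarrow> int) \<Rightarrow> real" and t s :: "nat \<Rightarrow> real"
  assumes I: "finite I" and s_top: "filterlim s at_top sequentially"
    and ev_bound: "eventually (\<lambda>n. \<forall>k\<in>I \<rightarrow>\<^sub>E UNIV. \<bar>s n ^ card I * F n k\<bar> \<le>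
       K * exp (- (\<Sum>i\<in>I. \<bar>(of_int (k i) - t n) / s n\<bar>))) sequentially"
    and lim: "\<And>x. x \<in> I \<rightarrow>\<^sub>E UNIV \<Longrightarrow> (\<lambda>n. s n ^ card I * F n (\<lambda>i\<in>I. \<lfloor>t n + s n * x i\<rfloor>)) \<longlonglongrightarrow> G x"
  shows "(\<lambda>n. integral\<^sup>L (count_space (I \<rightarrow>\<^sub>E UNIV)) (F n)) \<longlonglongrightarrow> (LINT x|(\<Pi>\<^sub>M i\<in>I. lborel). G x)"
proof -
  interpret product_sigma_finite "\<lambda>_. lborel :: real measure" ..
  have "eventually (\<lambda>n. s n \<ge> 1) sequentially" using s_top by (simp add: filterlim_at_top)
  from eventually_conj[OF this ev_bound] obtain N
    where N: "\<And>n. n \<ge> N \<Longrightarrow> s n \<ge> 1 \<and> (\<forall>k\<in>I \<rightarrow>\<^sub>E UNIV. \<bar>s n ^ card I * F n k\<bar> \<le>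
       K * exp (- (\<Sum>i\<in>I. \<bar>(of_int (k i) - t n) / s n\<bar>)))"
    unfolding eventually_sequentially by blast
  \<comment> \<open>The bounds hold only from \<open>N\<close> on, whereas dominated convergence
    asks for them at every index; the sequence is shifted and the shift removed at the end.\<close>
  define m where "m n = n + N" for n
  have s: "s (m n) \<ge> 1" for n using N[of "m n"] by (simp add: m_def)
  have bound: "\<bar>s (m n) ^ card I * F (m n) k\<bar> \<le> K * exp (- (\<Sum>i\<in>I. \<bar>(of_int (k i) - t (m n)) / s (m n)\<bar>))"
    if "k \<in> I \<rightarrow>\<^sub>E UNIV" for n k
    using N[of "m n", THEN conjunct2, rule_format, OF _ that] by (simp only: m_def le_add2)
  have spos: "s (m n) > 0" for n using s[of n] by simp
  let ?P = "\<Pi>\<^sub>M i\<in>I. (lborel :: real measure)"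
  let ?f = "\<lambda>n x. s (m n) ^ card I * F (m n) (\<lambda>i\<in>I. \<lfloor>t (m n) + s (m n) * x i\<rfloor>)"
  have lim': "(\<lambda>n. ?f n x) \<longlonglongrightarrow> G x" if "x \<in> I \<rightarrow>\<^sub>E UNIV" for x
    unfolding m_def by (rule LIMSEQ_ignore_initial_segment[OF lim[OF that]])
  have meas: "?f n \<in> borel_measurable ?P" for n
    by (rule measurable_compose[OF measurable_floor_scale[OF I]]) simp
  have K: "K \<ge> 0"
  proof -
    have "0 \<le> \<bar>s (m 0) ^ card I * F (m 0) (\<lambda>i\<in>I. 0)\<bar>" by simp
    also have "\<dots> \<le> K * exp (- (\<Sum>i\<in>I. \<bar>(of_int ((\<lambda>i\<in>I. 0) i) - t (m 0)) / s (m 0)\<bar>))"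
      by (rule bound) auto
    finally show ?thesis by (simp only: zero_le_mult_iff exp_ge_zero) simp
  qed
  let ?w = "\<lambda>x. K * (\<Prod>i\<in>I. exp 1 * exp (- \<bar>x i\<bar>))"
  have "(\<lambda>n. integral\<^sup>L ?P (?f n)) \<longlonglongrightarrow> integral\<^sup>L ?P G"
  proof (rule integral_dominated_convergence[where w = ?w])
    show "integrable ?P ?w"
      by (intro integrable_mult_right product_integrable_prod I integrable_exp_neg_abs)
    show "G \<in> borel_measurable ?P"
      by (rule borel_measurable_LIMSEQ_real[where u = ?f]) (use lim' meas in \<open>auto simp: space_PiM\<close>)
    show "AE x in ?P. (\<lambda>n. ?f n x) \<longlonglongrightarrow> G x"
      using lim' by (auto simp: space_PiM)
    fix n
    have "norm (?f n x) \<le> ?w x" for x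
    proof -
      define k where "k = (\<lambda>i\<in>I. \<lfloor>t (m n) + s (m n) * x i\<rfloor>)"
      have "norm (?f n x) \<le> K * exp (- (\<Sum>i\<in>I. \<bar>(of_int (k i) - t (m n)) / s (m n)\<bar>))"
        using bound[of k n] by (auto simp: k_def)
      also have "\<dots> \<le> K * exp (\<Sum>i\<in>I. 1 - \<bar>x i\<bar>)"
      proof -
        have "\<bar>x i\<bar> - 1 \<le> \<bar>(of_int (k i) - t (m n)) / s (m n)\<bar>" if "i \<in> I" for i
        proof -
          have "\<bar>(of_int (k i) - t (m n)) / s (m n) - x i\<bar> \<le> 1 / s (m n)"
            using that floor_scale_error[OF spos] by (simp add: k_def)
          also have "\<dots> \<le> 1" using s[of n] by simp
          finally show ?thesis by linarith
        qed
        then have "- (\<Sum>i\<in>I. \<bar>(of_int (k i) - t (m n)) / s (m n)\<bar>) \<le> (\<Sum>i\<in>I. 1 - \<bar>x i\<bar>)"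
          unfolding sum_negf[symmetric] by (intro sum_mono) fastforce
        then show ?thesis using K by (intro mult_left_mono) auto
      qed
      also have "\<dots> = ?w x"
        using I by (simp add: exp_sum exp_diff exp_minus divide_inverse)
      finally show ?thesis .
    qed
    then show "AE x in ?P. norm (?f n x) \<le> ?w x" by auto
  qed (use meas in auto)
  then have "(\<lambda>n. integral\<^sup>L (count_space (I \<rightarrow>\<^sub>E UNIV)) (F (n + N))) \<longlonglongrightarrow> integral\<^sup>L ?P G"
    by (simp only: integral_count_space_floor[OF I spos, symmetric] m_def[symmetric])
  then show ?thesis by (rule LIMSEQ_offset)
qed

subsection \<open>The two ensembles as lattice sums\<close>

lemma lattice_term_of_nat:
  assumes "l \<in> Omega M"
  shows "lattice_term M g \<alpha> (\<lambda>i\<in>{1..M}. int (l i)) = scaled_weight M \<alpha> l * g (rescale M \<alpha> l)"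
proof -
  have "(\<lambda>i\<in>{1..M}. nat ((\<lambda>i\<in>{1..M}. int (l i)) i)) = l"
    using assms by (auto simp: Omega_def PiE_iff extensional_def)
  then show ?thesis
    using assms unfolding lattice_term_def by (auto simp: Omega_def)
qed

lemma lattice_term_nonzero:
  assumes "lattice_term M g \<alpha> k \<noteq> 0"
  shows "(\<lambda>i\<in>{1..M}. nat (k i)) \<in> Omega M" "i \<in> {1..M} \<Longrightarrow> int (nat (k i)) = k i"
  using assms by (auto simp: lattice_term_def Omega_def nat_mono split: if_splits)

lemma integral_point_measure_real:
  fixes w f :: "'a \<Rightarrow> real"
  assumes "\<And>l. l \<in> A \<Longrightarrow> w l \<ge> 0"
  shows "integral\<^sup>L (point_measure A (\<lambda>l. ennreal (w l))) f = (LINT l|count_space A. w l * f l)"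
  unfolding point_measure_def
  by (subst integral_density) (use assms in \<open>auto simp: AE_count_space\<close>)

lemma W_nonneg: "W M l \<ge> 0"
  unfolding W_def by (intro prod_nonneg) auto

text \<open>Dividing by the power of \<open>sqrt (2 * \<alpha> / M)\<close> undoes the normalisation
  in \<open>scaled_weight\<close>; integer vectors outside \<open>Omega M\<close> contribute
  zero.\<close>

lemma integral_Charlier:
  assumes M: "M \<ge> 1" and \<alpha>: "\<alpha> > 0"
  shows "integral\<^sup>L (Charlier M \<alpha>) (\<lambda>l. g (rescale M \<alpha> l)) =
     (LINT k|count_space ({1..M} \<rightarrow>\<^sub>E UNIV). lattice_term M g \<alpha> k / sqrt (2 * \<alpha> / real M) ^ M)"
proof -
  let ?s = "sqrt (2 * \<alpha> / real M)"
  have s: "?s > 0" using M \<alpha> by simp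
  let ?h = "\<lambda>l. \<lambda>i\<in>{1..M}. int (l i)"
  have "integral\<^sup>L (Charlier M \<alpha>) (\<lambda>l. g (rescale M \<alpha> l)) =
     (LINT l|count_space (Omega M). (\<Prod>j\<in>{1..M-1}. 1 / fact j) * (V M l)\<^sup>2 * W M l *
        (\<Prod>i\<in>{1..M}. (\<alpha> / real M) ^ l i * exp (- \<alpha> / real M)) * g (rescale M \<alpha> l))"
    unfolding Charlier_def using \<alpha>
    by (intro integral_point_measure_real mult_nonneg_nonneg prod_nonneg) (auto simp: W_nonneg)
  also have "\<dots> = (LINT l|count_space (Omega M). lattice_term M g \<alpha> (?h l) / ?s ^ M)"
  proof (intro Bochner_Integration.integral_cong refl)
    fix l assume "l \<in> space (count_space (Omega M))"
    then have l: "l \<in> Omega M" by simp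
    have nz: "?s ^ M \<noteq> 0" using M \<alpha> by simp
    show "(\<Prod>j\<in>{1..M-1}. 1 / fact j) * (V M l)\<^sup>2 * W M l *
        (\<Prod>i\<in>{1..M}. (\<alpha> / real M) ^ l i * exp (- \<alpha> / real M)) * g (rescale M \<alpha> l) =
        lattice_term M g \<alpha> (?h l) / ?s ^ M"
      unfolding lattice_term_of_nat[OF l] scaled_weight_def
      by (simp only: mult.assoc nonzero_mult_div_cancel_left[OF nz])
  qed
  also have "\<dots> = (LINT k|count_space ({1..M} \<rightarrow>\<^sub>E UNIV). lattice_term M g \<alpha> k / ?s ^ M)"
  proof (rule integral_count_space_inj)
    show "inj_on ?h (Omega M)"
      by (rule inj_on_inverseI[where g = "\<lambda>k. \<lambda>i\<in>{1..M}. nat (k i)"])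
         (auto simp: Omega_def PiE_iff extensional_def)
    show "?h ` Omega M \<subseteq> {1..M} \<rightarrow>\<^sub>E UNIV" by auto
    fix k :: "nat \<Rightarrow> int" assume k: "k \<in> ({1..M} \<rightarrow>\<^sub>E UNIV) - ?h ` Omega M"
    have "lattice_term M g \<alpha> k = 0"
    proof (rule ccontr)
      assume nz: "lattice_term M g \<alpha> k \<noteq> 0"
      have "k = ?h (\<lambda>i\<in>{1..M}. nat (k i))"
        using lattice_term_nonzero(2)[OF nz] k by (fastforce simp: PiE_iff extensional_def)
      then show False using k lattice_term_nonzero(1)[OF nz] by blast
    qed
    then show "lattice_term M g \<alpha> k / ?s ^ M = 0" by simp
  qed
  finally show ?thesis .
qed

text \<open>The discrete analogue of \<open>hyperplane_param\<close>, with coordinate sum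
  \<open>N\<close> in place of 0. The last coordinate is an integer and may be negative, in which
  case \<open>lattice_term\<close> vanishes.\<close>

definition sum_ext :: "nat \<Rightarrow> nat \<Rightarrow> (nat \<Rightarrow> int) \<Rightarrow> nat \<Rightarrow> int" where
  "sum_ext M N k = k(M := int N - (\<Sum>i\<in>{1..M-1}. k i))"

lemma insert_last: "M \<ge> 1 \<Longrightarrow> {1..M} = insert M {1..M-1}" for M :: nat
  by auto

lemma sum_last:
  fixes f :: "nat \<Rightarrow> 'a :: comm_monoid_add"
  assumes "M \<ge> 1"
  shows "sum f {1..M} = f M + sum f {1..M-1}"
  using assms by (subst insert_last[OF assms]) simp

text \<open>On vectors of sum N the Poisson factors multiply to the constant (N / M)^N exp (- N), so
  the fixed-sum weight is N! exp N / N^N times the Charlier weight at \<alpha> = N. Only M - 1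
  coordinates are free, so one of the M factors \<open>s\<close> of \<open>scaled_weight\<close> is
  left over and sits in the denominator of the prefactor.\<close>

lemma integral_Ch_fixed:
  assumes M: "M \<ge> 1" and N: "N \<ge> 1"
  defines "s \<equiv> sqrt (2 * real N / real M)"
  shows "integral\<^sup>L (Ch_fixed M N) (\<lambda>l. g (rescale M (real N) l)) =
     fact N * exp (real N) / (real N ^ N * s) *
     (LINT k|count_space ({1..M-1} \<rightarrow>\<^sub>E UNIV). lattice_term M g (real N) (sum_ext M N k) / s ^ (M - 1))"
proof -
  define r where "r = fact N * exp (real N) / (real N ^ N * s)"
  have s: "s > 0" using M N by (simp add: s_def)
  let ?h = "\<lambda>l. \<lambda>i\<in>{1..M-1}. int (l i)"
  have ext: "sum_ext M N (?h l) = (\<lambda>i\<in>{1..M}. int (l i))" if l: "l \<in> Omega_sum M N" for l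
  proof -
    have "int N = int (l M) + (\<Sum>i\<in>{1..M-1}. int (l i))"
      using l sum_last[OF M, of l] by (auto simp: Omega_sum_def)
    then have "int N - (\<Sum>i\<in>{1..M-1}. ?h l i) = int (l M)"
      by simp
    then show ?thesis
      using M unfolding sum_ext_def by (auto simp: fun_eq_iff)
  qed
  have "integral\<^sup>L (Ch_fixed M N) (\<lambda>l. g (rescale M (real N) l)) =
     (LINT l|count_space (Omega_sum M N). fact N / real M ^ N * (\<Prod>j\<in>{1..M-1}. 1 / fact j) * (V M l)\<^sup>2 * W M l
        * g (rescale M (real N) l))"
    unfolding Ch_fixed_def
    by (intro integral_point_measure_real mult_nonneg_nonneg prod_nonneg) (auto simp: W_nonneg)
  also have "\<dots> = (LINT l|count_space (Omega_sum M N). r * (lattice_term M g (real N) (sum_ext M N (?h l)) / s ^ (M - 1)))"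
  proof (intro Bochner_Integration.integral_cong refl)
    fix l assume "l \<in> space (count_space (Omega_sum M N))"
    then have l: "l \<in> Omega_sum M N" by simp
    then have l': "l \<in> Omega M" "(\<Sum>i=1..M. l i) = N" by (auto simp: Omega_sum_def)
    have "(\<Prod>i\<in>{1..M}. (real N / real M) ^ l i * exp (- real N / real M)) = (real N / real M) ^ N * exp (- real N)"
    proof -
      have "exp (- real N / real M) ^ M = exp (- real N)"
        using M by (simp flip: exp_of_nat_mult)
      then show ?thesis
        by (simp add: prod.distrib power_sum flip: l'(2))
    qed
    then have "scaled_weight M (real N) l = s ^ M * ((\<Prod>j\<in>{1..M-1}. 1 / fact j) * (V M l)\<^sup>2 * W M l *
       ((real N / real M) ^ N * exp (- real N)))"
      by (simp add: scaled_weight_def s_def)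
    moreover have "s ^ M = s * s ^ (M - 1)" using M by (metis power_minus_mult mult.commute less_le_trans zero_less_one)
    ultimately have "r * (scaled_weight M (real N) l / s ^ (M - 1)) =
        fact N / real M ^ N * (\<Prod>j\<in>{1..M-1}. 1 / fact j) * (V M l)\<^sup>2 * W M l"
      using s N by (simp add: r_def power_divide exp_minus field_simps)
    then show "fact N / real M ^ N * (\<Prod>j\<in>{1..M-1}. 1 / fact j) * (V M l)\<^sup>2 * W M l * g (rescale M (real N) l) =
       r * (lattice_term M g (real N) (sum_ext M N (?h l)) / s ^ (M - 1))"
      unfolding ext[OF l] lattice_term_of_nat[OF l'(1)] by (metis mult.assoc times_divide_eq_left)
  qed
  also have "\<dots> = r * (LINT l|count_space (Omega_sum M N). lattice_term M g (real N) (sum_ext M N (?h l)) / s ^ (M - 1))"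
    by (rule integral_mult_right_zero)
  also have "(LINT l|count_space (Omega_sum M N). lattice_term M g (real N) (sum_ext M N (?h l)) / s ^ (M - 1)) =
    (LINT k|count_space ({1..M-1} \<rightarrow>\<^sub>E UNIV). lattice_term M g (real N) (sum_ext M N k) / s ^ (M - 1))"
  proof (rule integral_count_space_inj)
    show "inj_on ?h (Omega_sum M N)"
    proof (rule inj_on_inverseI[where g = "\<lambda>k. \<lambda>i\<in>{1..M}. nat (sum_ext M N k i)"])
      fix l assume l: "l \<in> Omega_sum M N"
      then show "(\<lambda>i\<in>{1..M}. nat (sum_ext M N (?h l) i)) = l"
        unfolding ext[OF l] by (auto simp: Omega_sum_def Omega_def PiE_iff extensional_def)
    qed
    show "?h ` Omega_sum M N \<subseteq> {1..M-1} \<rightarrow>\<^sub>E UNIV" by auto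
    fix k :: "nat \<Rightarrow> int" assume k: "k \<in> ({1..M-1} \<rightarrow>\<^sub>E UNIV) - ?h ` Omega_sum M N"
    \<comment> \<open>A nonzero term makes all coordinates of the completed vector, the last
      included, nonnegative and weakly decreasing. They then form an element of
      \<open>Omega_sum M N\<close> whose image is \<open>k\<close>.\<close>
    have "lattice_term M g (real N) (sum_ext M N k) = 0"
    proof (rule ccontr)
      assume nz: "lattice_term M g (real N) (sum_ext M N k) \<noteq> 0"
      define l where "l = (\<lambda>i\<in>{1..M}. nat (sum_ext M N k i))"
      have l: "l \<in> Omega M" unfolding l_def by (rule lattice_term_nonzero(1)[OF nz])
      have li: "int (l i) = sum_ext M N k i" if "i \<in> {1..M}" for i
        using lattice_term_nonzero(2)[OF nz that] that by (simp add: l_def)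
      have kM: "sum_ext M N k i = k i" if "i \<in> {1..M-1}" for i
        using that by (auto simp: sum_ext_def)
      have "int (\<Sum>i=1..M. l i) = (\<Sum>i=1..M. sum_ext M N k i)"
        unfolding of_nat_sum by (intro sum.cong refl li)
      also have "\<dots> = sum_ext M N k M + (\<Sum>i=1..M-1. k i)"
        unfolding sum_last[OF M] using kM by (intro arg_cong2[of _ _ _ _ "(+)"] sum.cong) auto
      also have "\<dots> = int N" by (simp add: sum_ext_def)
      finally have "(\<Sum>i=1..M. l i) = N" by (simp only: of_nat_eq_iff)
      then have "l \<in> Omega_sum M N" using l by (simp add: Omega_sum_def)
      moreover have "k = ?h l"
      proof
        fix i show "k i = ?h l i"
        proof (cases "i \<in> {1..M-1}")
          case True
          then have "i \<in> {1..M}" by auto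
          with True show ?thesis by (simp add: li kM)
        next
          case False
          then have "k i = undefined" using k by (auto simp: PiE_iff extensional_def)
          then show ?thesis by (simp only: restrict_def False if_False)
        qed
      qed
      ultimately show False using k by blast
    qed
    then show "lattice_term M g (real N) (sum_ext M N k) / s ^ (M - 1) = 0" by simp
  qed
  finally show ?thesis by (simp add: r_def)
qed

section \<open>Both limits by dominated convergence\<close>

lemma filterlim_sqrt_scale:
  assumes "M \<ge> 1" "filterlim \<alpha> at_top sequentially"
  shows "filterlim (\<lambda>n. sqrt (2 * \<alpha> n / real M)) at_top sequentially"
proof -
  have "filterlim (\<lambda>n. (2 / real M) * \<alpha> n) at_top sequentially"
    by (rule filterlim_tendsto_pos_mult_at_top[OF tendsto_const _ assms(2)]) (use assms(1) in simp)
  from filterlim_compose[OF sqrt_at_top this] show ?thesis by simp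
qed

text \<open>The exponential growth bound on \<open>g\<close> supplies the integrable majorant.
  Continuity alone does not ensure convergence: for g(x) = exp (2 |x|^2) the integral over the
  chamber diverges.\<close>

theorem theorem1p6:
  fixes M :: nat and g :: "(nat \<Rightarrow> real) \<Rightarrow> real" and C c :: real
  assumes M: "M \<ge> 1"
    and cont: "continuous_map (product_topology (\<lambda>_. euclideanreal) {1..M}) euclideanreal g"
    and growth: "\<And>x. x \<in> {1..M} \<rightarrow>\<^sub>E UNIV \<Longrightarrow> \<bar>g x\<bar> \<le> C * exp (c * (\<Sum>i=1..M. \<bar>x i\<bar>))"
  shows "((\<lambda>N. integral\<^sup>L (Ch_fixed M N) (\<lambda>l. g (rescale M (real N) l)))
            \<longlonglongrightarrow> fact M * sqrt (pi * real M) * A_integral M (\<lambda>x. g x * phi_GUE M x)) \<and>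
         ((\<lambda>\<alpha>. integral\<^sup>L (Charlier M \<alpha>) (\<lambda>l. g (rescale M \<alpha> l)))
            \<longlongrightarrow> fact M * (LINT x:chamber M|(\<Pi>\<^sub>M i\<in>{1..M}. lborel). g x * phi_GUE M x)) at_top"
proof
  have "\<exists>K T. T > 0 \<and> (\<forall>\<alpha>\<ge>T. \<forall>k. \<bar>lattice_term M g \<alpha> k\<bar> \<le>
     K * exp (- (\<Sum>i=1..M. \<bar>(of_int (k i) - \<alpha> / real M) / sqrt (2 * \<alpha> / real M)\<bar>)))"
    by (rule lattice_term_bound[OF M, of g C c]) (rule growth)
  then obtain K T where T: "T > 0" and bound: "\<And>\<alpha> k. \<alpha> \<ge> T \<Longrightarrow> \<bar>lattice_term M g \<alpha> k\<bar> \<le>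
     K * exp (- (\<Sum>i=1..M. \<bar>(of_int (k i) - \<alpha> / real M) / sqrt (2 * \<alpha> / real M)\<bar>))"
    by blast
  have K: "K \<ge> 0"
  proof -
    have "0 \<le> \<bar>lattice_term M g T (\<lambda>_. 0)\<bar>" by simp
    also note bound[OF order_refl, of "\<lambda>_. 0"]
    finally show ?thesis by (simp add: zero_le_mult_iff)
  qed

  \<comment> \<open>The Charlier ensemble\<close>
  show "((\<lambda>\<alpha>. integral\<^sup>L (Charlier M \<alpha>) (\<lambda>l. g (rescale M \<alpha> l)))
            \<longlongrightarrow> fact M * (LINT x:chamber M|(\<Pi>\<^sub>M i\<in>{1..M}. lborel). g x * phi_GUE M x)) at_top"
  \<comment> \<open>The continuous parameter is reduced to arbitrary sequences tending to infinity,
    the setting of the dominated convergence theorem.\<close>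
  proof (rule tendsto_at_topI_sequentially)
    fix \<alpha> :: "nat \<Rightarrow> real" assume \<alpha>: "filterlim \<alpha> at_top sequentially"
    define s where "s n = sqrt (2 * \<alpha> n / real M)" for n
    define t where "t n = \<alpha> n / real M" for n
    have s: "filterlim s at_top sequentially"
      unfolding s_def by (rule filterlim_sqrt_scale[OF M \<alpha>])
    have spos: "eventually (\<lambda>n. s n > 0) sequentially" using s by (simp add: filterlim_at_top_dense)
    have \<alpha>T: "eventually (\<lambda>n. \<alpha> n \<ge> T) sequentially" using \<alpha> by (simp add: filterlim_at_top)
    have "(\<lambda>n. LINT k|count_space ({1..M} \<rightarrow>\<^sub>E UNIV). lattice_term M g (\<alpha> n) k / s n ^ M) \<longlonglongrightarrow>
        (LINT x|(\<Pi>\<^sub>M i\<in>{1..M}. lborel). indicator (chamber M) x * (fact M * (g x * phi_GUE M x)))"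
    proof (rule lattice_sum_limit[OF _ s])
      show "eventually (\<lambda>n. \<forall>k\<in>{1..M} \<rightarrow>\<^sub>E UNIV. \<bar>s n ^ card {1..M} * (lattice_term M g (\<alpha> n) k / s n ^ M)\<bar> \<le>
         K * exp (- (\<Sum>i\<in>{1..M}. \<bar>(of_int (k i) - t n) / s n\<bar>))) sequentially"
        using \<alpha>T spos
      proof eventually_elim
        case (elim n)
        show ?case
        proof
          fix k :: "nat \<Rightarrow> int"
          have "s n ^ card {1..M} * (lattice_term M g (\<alpha> n) k / s n ^ M) = lattice_term M g (\<alpha> n) k"
            using elim(2) by simp
          then show "\<bar>s n ^ card {1..M} * (lattice_term M g (\<alpha> n) k / s n ^ M)\<bar> \<le>
             K * exp (- (\<Sum>i\<in>{1..M}. \<bar>(of_int (k i) - t n) / s n\<bar>))"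
            using bound[OF elim(1), of k] by (simp only: s_def t_def)
        qed
      qed
      fix x :: "nat \<Rightarrow> real" assume x: "x \<in> {1..M} \<rightarrow>\<^sub>E UNIV"
      have "(\<lambda>n. lattice_term M g (\<alpha> n) (\<lambda>i\<in>{1..M}. \<lfloor>t n + s n * x i\<rfloor>)) \<longlonglongrightarrow>
          indicator (chamber M) x * (fact M * (g x * phi_GUE M x))"
        by (rule lattice_term_limit[OF M cont \<alpha> x])
           (use floor_scale_limit[OF s, of t] in \<open>simp add: s_def t_def\<close>)
      then show "(\<lambda>n. s n ^ card {1..M} * (lattice_term M g (\<alpha> n) (\<lambda>i\<in>{1..M}. \<lfloor>t n + s n * x i\<rfloor>) / s n ^ M)) \<longlonglongrightarrow>
          indicator (chamber M) x * (fact M * (g x * phi_GUE M x))"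
        by (rule Lim_transform_eventually) (use spos in \<open>auto elim!: eventually_mono\<close>)
    qed simp
    also have "(LINT x|(\<Pi>\<^sub>M i\<in>{1..M}. lborel). indicator (chamber M) x * (fact M * (g x * phi_GUE M x))) =
        fact M * (LINT x:chamber M|(\<Pi>\<^sub>M i\<in>{1..M}. lborel). g x * phi_GUE M x)"
      unfolding set_lebesgue_integral_def integral_mult_right_zero[symmetric]
      by (intro Bochner_Integration.integral_cong refl) simp
    finally show "(\<lambda>n. integral\<^sup>L (Charlier M (\<alpha> n)) (\<lambda>l. g (rescale M (\<alpha> n) l))) \<longlonglongrightarrow>
        fact M * (LINT x:chamber M|(\<Pi>\<^sub>M i\<in>{1..M}. lborel). g x * phi_GUE M x)"
    proof (rule Lim_transform_eventually)
      show "eventually (\<lambda>n. (LINT k|count_space ({1..M} \<rightarrow>\<^sub>E UNIV). lattice_term M g (\<alpha> n) k / s n ^ M) =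
          integral\<^sup>L (Charlier M (\<alpha> n)) (\<lambda>l. g (rescale M (\<alpha> n) l))) sequentially"
        using \<alpha>T by eventually_elim (use T in \<open>simp add: integral_Charlier[OF M] s_def\<close>)
    qed
  qed

  \<comment> \<open>The ensemble with fixed sum\<close>
  show "(\<lambda>N. integral\<^sup>L (Ch_fixed M N) (\<lambda>l. g (rescale M (real N) l)))
            \<longlonglongrightarrow> fact M * sqrt (pi * real M) * A_integral M (\<lambda>x. g x * phi_GUE M x)"
  proof -
    define s where "s N = sqrt (2 * real N / real M)" for N
    define t where "t N = real N / real M" for N
    have s: "filterlim s at_top sequentially"
      unfolding s_def by (rule filterlim_sqrt_scale[OF M filterlim_real_sequentially])
    have spos: "eventually (\<lambda>n. s n > 0) sequentially" using s by (simp add: filterlim_at_top_dense)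
    have NT: "eventually (\<lambda>N. real N \<ge> T) sequentially"
      using filterlim_real_sequentially by (simp add: filterlim_at_top)
    let ?I = "{1..M-1}"
    let ?x = "hyperplane_param M"
    have "(\<lambda>N. LINT k|count_space (?I \<rightarrow>\<^sub>E UNIV). lattice_term M g (real N) (sum_ext M N k) / s N ^ (M - 1)) \<longlonglongrightarrow>
        (LINT y|(\<Pi>\<^sub>M i\<in>?I. lborel). indicator (chamber M) (?x y) * (fact M * (g (?x y) * phi_GUE M (?x y))))"
    proof (rule lattice_sum_limit[OF _ s])
      show "eventually (\<lambda>N. \<forall>k\<in>?I \<rightarrow>\<^sub>E UNIV. \<bar>s N ^ card ?I * (lattice_term M g (real N) (sum_ext M N k) / s N ^ (M - 1))\<bar> \<le>
         K * exp (- (\<Sum>i\<in>?I. \<bar>(of_int (k i) - t N) / s N\<bar>))) sequentially"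
        using NT spos
      proof eventually_elim
        case (elim N)
        show ?case
        proof
          fix k :: "nat \<Rightarrow> int"
          have "\<bar>lattice_term M g (real N) (sum_ext M N k)\<bar> \<le>
             K * exp (- (\<Sum>i=1..M. \<bar>(of_int (sum_ext M N k i) - t N) / s N\<bar>))"
            using bound[OF elim(1), of "sum_ext M N k"] by (simp only: s_def t_def)
          \<comment> \<open>Dropping the dependent coordinate M from the exponent only enlarges the
            bound, since \<open>K \<ge> 0\<close>, and leaves a majorant in the M - 1 free
            ones.\<close>
          also have "\<dots> \<le> K * exp (- (\<Sum>i\<in>?I. \<bar>(of_int (k i) - t N) / s N\<bar>))"
          proof -
            have "(\<Sum>i\<in>?I. \<bar>(of_int (k i) - t N) / s N\<bar>) = (\<Sum>i\<in>?I. \<bar>(of_int (sum_ext M N k i) - t N) / s N\<bar>)"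
              by (intro sum.cong refl) (auto simp: sum_ext_def)
            also have "\<dots> \<le> (\<Sum>i=1..M. \<bar>(of_int (sum_ext M N k i) - t N) / s N\<bar>)"
              by (intro sum_mono2) auto
            finally show ?thesis using K by (intro mult_left_mono) auto
          qed
          finally show "\<bar>s N ^ card ?I * (lattice_term M g (real N) (sum_ext M N k) / s N ^ (M - 1))\<bar> \<le>
             K * exp (- (\<Sum>i\<in>?I. \<bar>(of_int (k i) - t N) / s N\<bar>))"
            using elim(2) by simp
        qed
      qed
      fix y :: "nat \<Rightarrow> real" assume y: "y \<in> ?I \<rightarrow>\<^sub>E UNIV"
      have xy: "?x y \<in> {1..M} \<rightarrow>\<^sub>E UNIV"
        using y M by (auto simp: hyperplane_param_def PiE_iff extensional_def)
      have yl: "(\<lambda>N. (of_int \<lfloor>t N + s N * y i\<rfloor> - t N) / s N) \<longlonglongrightarrow> y i" for i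
        by (rule floor_scale_limit[OF s])
      have "(\<lambda>N. lattice_term M g (real N) (sum_ext M N (\<lambda>i\<in>?I. \<lfloor>t N + s N * y i\<rfloor>))) \<longlonglongrightarrow>
          indicator (chamber M) (?x y) * (fact M * (g (?x y) * phi_GUE M (?x y)))"
      proof (rule lattice_term_limit[OF M cont filterlim_real_sequentially xy])
        fix i assume i: "i \<in> {1..M}"
        show "(\<lambda>N. (of_int (sum_ext M N (\<lambda>i\<in>?I. \<lfloor>t N + s N * y i\<rfloor>) i) - real N / real M) / sqrt (2 * real N / real M))
            \<longlonglongrightarrow> ?x y i"
        \<comment> \<open>Since N = M t, the deviations of all M coordinates from t sum to 0. The
          last deviation is thus minus the sum of the others, and its limit is the last coordinate
          of \<open>hyperplane_param\<close>.\<close>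
        proof (cases "i = M")
          case True
          have "(\<lambda>N. - (\<Sum>i\<in>?I. (of_int \<lfloor>t N + s N * y i\<rfloor> - t N) / s N)) \<longlonglongrightarrow> - (\<Sum>i\<in>?I. y i)"
            by (intro tendsto_minus tendsto_sum yl)
          moreover have "- (\<Sum>i\<in>?I. (of_int \<lfloor>t N + s N * y i\<rfloor> - t N) / s N) =
              (of_int (sum_ext M N (\<lambda>i\<in>?I. \<lfloor>t N + s N * y i\<rfloor>) i) - real N / real M) / sqrt (2 * real N / real M)" for N
          proof -
            have "real N - t N = real (M - 1) * t N"
              using M by (simp add: t_def of_nat_diff field_simps)
            then have "of_int (sum_ext M N (\<lambda>i\<in>?I. \<lfloor>t N + s N * y i\<rfloor>) i) - t N =
                - (\<Sum>i\<in>?I. of_int \<lfloor>t N + s N * y i\<rfloor> - t N)"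
              using True by (simp add: sum_ext_def sum_subtractf)
            then show ?thesis
              unfolding s_def[symmetric] t_def[symmetric] by (simp add: sum_divide_distrib)
          qed
          ultimately show ?thesis using True by (simp add: hyperplane_param_def)
        next
          case False
          then have "i \<in> ?I" using i by auto
          then show ?thesis using False yl[of i] by (simp add: sum_ext_def hyperplane_param_def s_def t_def)
        qed
      qed
      then show "(\<lambda>N. s N ^ card ?I * (lattice_term M g (real N) (sum_ext M N (\<lambda>i\<in>?I. \<lfloor>t N + s N * y i\<rfloor>)) / s N ^ (M - 1))) \<longlonglongrightarrow>
          indicator (chamber M) (?x y) * (fact M * (g (?x y) * phi_GUE M (?x y)))"
        by (rule Lim_transform_eventually) (use spos in \<open>auto elim!: eventually_mono\<close>)
    qed simp
    also have "(LINT y|(\<Pi>\<^sub>M i\<in>?I. lborel). indicator (chamber M) (?x y) * (fact M * (g (?x y) * phi_GUE M (?x y)))) =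
        fact M * A_integral M (\<lambda>x. g x * phi_GUE M x)"
      unfolding A_integral_def set_lebesgue_integral_def integral_mult_right_zero[symmetric]
    proof (intro Bochner_Integration.integral_cong refl)
      fix y :: "nat \<Rightarrow> real"
      \<comment> \<open>Every parametrized point has coordinate sum 0, so membership in
        \<open>A_set\<close> reduces to membership in the chamber.\<close>
      have "(\<Sum>i=1..M. ?x y i) = ?x y M + (\<Sum>i\<in>?I. ?x y i)" by (rule sum_last[OF M])
      also have "(\<Sum>i\<in>?I. ?x y i) = (\<Sum>i\<in>?I. y i)"
        by (intro sum.cong refl) (auto simp: hyperplane_param_def)
      finally have "(\<Sum>i=1..M. ?x y i) = 0" by (simp add: hyperplane_param_def)
      then have "?x y \<in> A_set M \<longleftrightarrow> ?x y \<in> chamber M" by (simp add: A_set_def)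
      then show "indicator (chamber M) (?x y) * (fact M * (g (?x y) * phi_GUE M (?x y))) =
          fact M * (indicator {y. ?x y \<in> A_set M} y *\<^sub>R (g (?x y) * phi_GUE M (?x y)))"
        by (simp add: indicator_def)
    qed
    finally have "(\<lambda>N. LINT k|count_space (?I \<rightarrow>\<^sub>E UNIV). lattice_term M g (real N) (sum_ext M N k) / s N ^ (M - 1)) \<longlonglongrightarrow>
        fact M * A_integral M (\<lambda>x. g x * phi_GUE M x)" .
    moreover have "(\<lambda>N. fact N * exp (real N) / (real N ^ N * s N)) \<longlonglongrightarrow> sqrt (pi * real M)"
    proof -
      \<comment> \<open>Here \<open>s N\<close> is \<open>sqrt (2 * N) / sqrt M\<close>, and this
        \<open>sqrt M\<close> combines with the Stirling limit \<open>sqrt pi\<close> to give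
        \<open>sqrt (pi * M)\<close>.\<close>
      have "fact N * exp (real N) / (real N ^ N * sqrt (2 * real N)) * sqrt (real M) =
          fact N * exp (real N) / (real N ^ N * s N)" for N
        unfolding s_def real_sqrt_divide by simp
      then show ?thesis
        using tendsto_mult[OF fact_stirling_ratio tendsto_const[of "sqrt (real M)"]]
        by (simp add: real_sqrt_mult)
    qed
    ultimately have "(\<lambda>N. fact N * exp (real N) / (real N ^ N * s N) *
       (LINT k|count_space (?I \<rightarrow>\<^sub>E UNIV). lattice_term M g (real N) (sum_ext M N k) / s N ^ (M - 1))) \<longlonglongrightarrow>
       sqrt (pi * real M) * (fact M * A_integral M (\<lambda>x. g x * phi_GUE M x))"
      by (intro tendsto_mult)
    then have "(\<lambda>N. integral\<^sup>L (Ch_fixed M N) (\<lambda>l. g (rescale M (real N) l))) \<longlonglongrightarrow>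
       sqrt (pi * real M) * (fact M * A_integral M (\<lambda>x. g x * phi_GUE M x))"
    proof (rule Lim_transform_eventually)
      show "eventually (\<lambda>N. fact N * exp (real N) / (real N ^ N * s N) *
       (LINT k|count_space (?I \<rightarrow>\<^sub>E UNIV). lattice_term M g (real N) (sum_ext M N k) / s N ^ (M - 1)) =
         integral\<^sup>L (Ch_fixed M N) (\<lambda>l. g (rescale M (real N) l))) sequentially"
        using eventually_ge_at_top[of 1]
        by eventually_elim (simp only: integral_Ch_fixed[OF M] s_def)
    qed
    then show ?thesis by (simp add: mult_ac)
  qed
qed

end
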